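(* Let $A\in\mathbb{R}^{n\times n}$ be a matrix diagonalizable over $\mathbb{C}$. Suppose that all eigenvalues of $A$ are algebraic integers having the same minimal polynomial $f$ (over $\mathbb{Q}$), of degree $d$. Denote $M:=\max\{m_A(\beta):\beta\text{ a root of }f\}\ (\geq 1)$ and $m:=\min\{m_A(\beta):\beta\text{ a root of }f\}\ (\geq 0)$. Let $\Lambda=(\mathcal{L}\subset\mathbb{R}^s,\mathbb{R}^n)$ be a generic cut-and-project scheme with self-similarity $A$ such that the dimension $s$ of the lattice is as small as possible. Then $s=Md$ if $m<M$, and $s=(M+1)d$ otherwise.
   Context: For a matrix $T$ and $\lambda\in\mathbb{C}$, $m_T(\lambda)$ denotes the algebraic multiplicity of $\lambda$ as an eigenvalue of $T$ ($m_T(\lambda)=0$ if $\lambda$ is not an eigenvalue). A lattice $\mathcal{L}\subset\mathbb{R}^s$ is a set $\{L\mathbf{r}:\mathbf{r}\in\mathbb{Z}^s\}$ for a non-singular $L\in\mathbb{R}^{s\times s}$, called a matrix associated to $\mathcal{L}$. For $1\le n<s$, the cut-and-project scheme $\Lambda=(\mathcal{L}\subset\mathbb{R}^s,\mathbb{R}^n)$ consists of $\mathcal{L}$ with projections $\pi_\parallel(\mathbf{x})=(x_1,\dots,x_n)^\top$, $\pi_\perp(\mathbf{x})=(x_{n+1},\dots,x_s)^\top$. It is non-degenerate if $\pi_\parallel|_{\mathcal{L}}$ is injective, aperiodic if $\pi_\perp|_{\mathcal{L}}$ is injective, irreducible if $\pi_\perp(\mathcal{L})$ is dense in $\mathbb{R}^{s-n}$,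 and generic if all three hold. A matrix $A\in\mathbb{R}^{n\times n}$ is a self-similarity of a generic scheme $\Lambda$ with associated matrix $L$ if $A\pi_\parallel(\mathcal{L})\subset\pi_\parallel(\mathcal{L})$ and there exist $C\in\mathbb{Z}^{s\times s}$, $B\in\mathbb{R}^{(s-n)\times(s-n)}$ with $\begin{pmatrix}A&O\\O&B\end{pmatrix}L=LC$. *)

theory Defs
  imports "Jordan_Normal_Form.Jordan_Normal_Form" "HOL-Computational_Algebra.Polynomial"
begin

definition alg_mult :: "complex mat \<Rightarrow> complex \<Rightarrow> nat" where
  "alg_mult T z = order z (char_poly T)"

definition eigenvalues_C :: "complex mat \<Rightarrow> complex set" where
  "eigenvalues_C T = {z. poly (char_poly T) z = 0}"

definition is_min_poly_Q :: "rat poly \<Rightarrow> complex \<Rightarrow> bool" where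
  "is_min_poly_Q f \<beta> \<longleftrightarrow> f \<noteq> 0 \<and> lead_coeff f = 1 \<and> poly (map_poly of_rat f) \<beta> = 0 \<and>
     (\<forall>g. g \<noteq> 0 \<and> poly (map_poly of_rat g) \<beta> = 0 \<longrightarrow> degree f \<le> degree g)"

definition roots_C :: "rat poly \<Rightarrow> complex set" where
  "roots_C f = {\<beta>. poly (map_poly of_rat f) \<beta> = 0}"

definition diagonalizable_C :: "complex mat \<Rightarrow> bool" where
  "diagonalizable_C T \<longleftrightarrow> (\<exists>D. diagonal_mat D \<and> similar_mat T D)"

definition lattice :: "real mat \<Rightarrow> real vec set" where
  "lattice L = {L *\<^sub>v r | r. r \<in> carrier_vec (dim_col L) \<and> (\<forall>i < dim_col L. r $ i \<in> \<int>)}"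

definition proj_par :: "nat \<Rightarrow> real vec \<Rightarrow> real vec" where
  "proj_par n x = vec n (\<lambda>i. x $ i)"

definition proj_perp :: "nat \<Rightarrow> real vec \<Rightarrow> real vec" where
  "proj_perp n x = vec (dim_vec x - n) (\<lambda>i. x $ (n + i))"

(* X dense in R^k (coordinatewise / sup-norm metric, equivalent to the Euclidean topology) *)
definition dense_in_Rk :: "nat \<Rightarrow> real vec set \<Rightarrow> bool" where
  "dense_in_Rk k X \<longleftrightarrow> (\<forall>x \<in> carrier_vec k. \<forall>\<epsilon> > 0. \<exists>y \<in> X. \<forall>i < k. \<bar>x $ i - y $ i\<bar> < \<epsilon>)"

definition cps :: "nat \<Rightarrow> nat \<Rightarrow> real mat \<Rightarrow> bool" where
  "cps s n L \<longleftrightarrow> 1 \<le> n \<and> n < s \<and> L \<in> carrier_mat s s \<and> det L \<noteq> 0"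

definition generic_cps :: "nat \<Rightarrow> nat \<Rightarrow> real mat \<Rightarrow> bool" where
  "generic_cps s n L \<longleftrightarrow> cps s n L \<and>
     inj_on (proj_par n) (lattice L) \<and>
     inj_on (proj_perp n) (lattice L) \<and>
     dense_in_Rk (s - n) (proj_perp n ` lattice L)"

definition self_similarity :: "nat \<Rightarrow> nat \<Rightarrow> real mat \<Rightarrow> real mat \<Rightarrow> bool" where
  "self_similarity s n L A \<longleftrightarrow> generic_cps s n L \<and> A \<in> carrier_mat n n \<and>
     (\<forall>x \<in> proj_par n ` lattice L. A *\<^sub>v x \<in> proj_par n ` lattice L) \<and>
     (\<exists>C B. C \<in> carrier_mat s s \<and> (\<forall>i < s. \<forall>j < s. C $$ (i, j) \<in> \<int>) \<and>
            B \<in> carrier_mat (s - n) (s - n) \<and>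
            four_block_mat A (0\<^sub>m n (s - n)) (0\<^sub>m (s - n) n) B * L = L * C)"

end

theory Submission
  imports Defs "Berlekamp_Zassenhaus.Factor_Bound" "HOL-Computational_Algebra.Fundamental_Theorem_Algebra"
    "HOL-Analysis.Kronecker_Approximation_Theorem"
begin

text \<open>
  Lower bound. A self-similarity gives an integer matrix \<open>C\<close>, similar to \<open>diag(A, B)\<close>, with
  \<open>A \<pi> = \<pi> C\<close> where \<open>\<pi>\<close> is the matrix of the parallel projection of the lattice. As \<open>A\<close> is
  diagonalizable, \<open>f(A) = 0\<close>, so \<open>\<pi> f(C) = 0\<close>, and non-degeneracy forces \<open>f(C) = 0\<close>. Hence the
  characteristic polynomial of \<open>C\<close> is a power \<open>f^k\<close>, i.e. \<open>s = k d\<close>, and \<open>k \<ge> M\<close>. If all roots of \<open>f\<close>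
  have multiplicity \<open>M\<close> in \<open>A\<close>, then \<open>n = M d < s\<close> and so \<open>k \<ge> M + 1\<close>.

  Existence. Let \<open>N\<close> be \<open>M\<close> or \<open>M + 1\<close>, respectively, and let \<open>C\<close> consist of \<open>N\<close> diagonal copies of the
  companion matrix of \<open>f\<close>. Over the reals \<open>C\<close> is similar to \<open>diag(A, B)\<close> for some \<open>B\<close>. The similarity can be
  composed with any \<open>T \<otimes> 1\<close>, which commutes with \<open>C\<close>; a rank-one perturbation \<open>T\<close> of the identity,
  outside the zeros of countably many non-zero polynomials, makes both projections injective on the
  integer points. It also makes the kernel of the perpendicular projection contain a vector with
  rationally independent coordinates, and density follows from Kronecker's theorem.
\<close>

text \<open>The arithmetic input is that every non-zero rational vector is cyclic for the companion
  matrix, because Q[x]/(f) is a field. Hence a real matrix that intertwines some \<open>B\<close>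
  with the companion matrix and kills one such vector is zero. For several copies this yields only a
  non-zero product of some column block with some block of the integer vector; the products of
  different blocks may still cancel in the sum. The twist prevents this: its entries t^(1+i+Nj) have
  pairwise distinct exponents, so every pair of blocks owns a coefficient of a polynomial in t. Rank
  one keeps the inverse explicit, which matters because the independent kernel vector is moved by
  the inverse twist.

  Irreducibility also explains why f(C) = 0 yields a power of \<open>f\<close>: the characteristic
  polynomial of \<open>C\<close> is rational, and a rational polynomial has the same order at all
  roots of \<open>f\<close>. The coefficients of \<open>f\<close> are integers by Gauss's lemma;
  this makes \<open>C\<close> integral in the construction, and the columns of f(C) lattice
  coordinates in the lower bound.\<close>

unbundle no inner_syntax and no vec_syntax
hide_type (open) Finite_Cartesian_Product.vec
hide_const (open) Finite_Cartesian_Product.vec Finite_Cartesian_Product.mat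
  Finite_Cartesian_Product.row Finite_Cartesian_Product.transpose Coset.order up_ring.coeff up_ring.monom module.smult

section \<open>Minimal polynomials over the rationals\<close>

interpretation of_rat_poly_hom: map_poly_inj_idom_divide_hom of_rat ..

lemma complex_of_real_of_rat: "complex_of_real (of_rat x) = of_rat x"
  by (cases x) (simp add: of_rat_rat)

lemma map_poly_complex_of_rat:
  "map_poly complex_of_real (map_poly of_rat p) = map_poly of_rat p"
  by (intro poly_eqI) (simp add: coeff_map_poly complex_of_real_of_rat)

lemma degree_eq_sum_order:
  fixes p :: "complex poly"
  assumes "finite S" and roots: "{z. poly p z = 0} \<subseteq> S" and "p \<noteq> 0"
  shows "degree p = (\<Sum>z\<in>S. order z p)"
proof -
  have "degree p = size (proots p)"
    by (simp add: size_proots_complex)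
  also have "\<dots> = (\<Sum>z\<in>set_mset (proots p). order z p)"
    using \<open>p \<noteq> 0\<close> by (simp add: size_multiset_overloaded_eq)
  also have "\<dots> = (\<Sum>z\<in>S. order z p)"
    using assms by (intro sum.mono_neutral_left) (auto simp: order_root)
  finally show ?thesis .
qed

text \<open>Minimality is assumed at one number only; the lemmas below transfer it to arbitrary
  roots of \<open>f\<close>, since the conjugates of an eigenvalue of \<open>A\<close> need not be
  eigenvalues.\<close>

locale min_poly_Q =
  fixes f :: "rat poly" and \<beta>\<^sub>0 :: complex
  assumes min_poly: "is_min_poly_Q f \<beta>\<^sub>0"
begin

lemma f_nz: "f \<noteq> 0" and monic_f: "lead_coeff f = 1"
  and min_poly_root: "\<beta>\<^sub>0 \<in> roots_C f"
  using min_poly by (auto simp: is_min_poly_Q_def roots_C_def)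

lemma degree_le: "g \<noteq> 0 \<Longrightarrow> poly (map_poly of_rat g) \<beta>\<^sub>0 = 0 \<Longrightarrow> degree f \<le> degree g"
  using min_poly by (auto simp: is_min_poly_Q_def)

text \<open>Irreducibility of \<open>f\<close> in the form used throughout. By Bezout the gcd
  \<open>h\<close> of \<open>f\<close> and \<open>g\<close> vanishes at \<open>\<gamma>\<close> and
  so is not constant; as one of the two factors of \<open>f = h * k\<close> vanishes at
  \<open>\<beta>\<^sub>0\<close>, minimality of the degree leaves only a constant
  \<open>k\<close>.\<close>

lemma dvd_if_common_root:
  assumes "\<gamma> \<in> roots_C f" and g0: "poly (map_poly of_rat g) \<gamma> = 0"
  shows "f dvd g"
proof -
  have f0: "poly (map_poly of_rat f) \<gamma> = 0" using assms by (simp add: roots_C_def)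
  define h where "h = gcd f g"
  obtain k where k: "f = h * k" unfolding h_def by (metis dvd_def gcd_dvd1)
  have nz: "h \<noteq> 0" "k \<noteq> 0" using f_nz k by auto
  have deg: "degree f = degree h + degree k" using nz k by (simp add: degree_mult_eq)
  obtain a b where "a * f + b * g = h" unfolding h_def
    using bezout_coefficients_fst_snd by metis
  hence "poly (map_poly of_rat h) \<gamma> = 0"
    using f0 g0 by (auto simp: of_rat_poly_hom.hom_add of_rat_poly_hom.hom_mult)
  have "degree h \<noteq> 0"
  proof
    assume "degree h = 0"
    then obtain c where "h = [:c:]" by (elim degree_eq_zeroE)
    thus False using \<open>poly (map_poly of_rat h) \<gamma> = 0\<close> nz(1) by simp
  qed
  have "poly (map_poly of_rat h) \<beta>\<^sub>0 = 0 \<or> poly (map_poly of_rat k) \<beta>\<^sub>0 = 0"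
    using min_poly_root k by (simp add: roots_C_def of_rat_poly_hom.hom_mult)
  hence "degree f \<le> degree h \<or> degree f \<le> degree k"
    using degree_le nz by blast
  hence "degree k = 0" using deg \<open>degree h \<noteq> 0\<close> by linarith
  hence "is_unit k" using nz(2) by (auto elim!: degree_eq_zeroE)
  hence "f dvd h" using k by (simp add: mult_unit_dvd_iff)
  thus ?thesis by (simp add: h_def)
qed

lemma poly_small_nz:
  assumes "\<gamma> \<in> roots_C f" "g \<noteq> 0" "degree g < degree f"
  shows "poly (map_poly of_rat g) \<gamma> \<noteq> 0"
  using dvd_if_common_root[OF assms(1), of g] dvd_imp_degree_le[of f g] assms(2,3) by linarith

lemma degree_f_pos: "degree f > 0"
proof (rule ccontr)
  assume "\<not> degree f > 0"
  hence "f = [:1:]" using monic_f by (metis degree_eq_zeroE lead_coeff_pCons(2) not_gr_zero pCons_0_0)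
  thus False using min_poly_root by (simp add: roots_C_def)
qed

lemma finite_roots: "finite (roots_C f)"
  unfolding roots_C_def using f_nz by (intro poly_roots_finite) simp

text \<open>Separability: the derivative is non-zero of smaller degree, so it has no root in common
  with \<open>f\<close>.\<close>

lemma order_f:
  assumes "\<gamma> \<in> roots_C f"
  shows "order \<gamma> (map_poly of_rat f) = 1"
proof -
  have "pderiv f \<noteq> 0" "degree (pderiv f) < degree f"
    using degree_f_pos by (auto simp: pderiv_eq_0_iff degree_pderiv)
  hence "poly (pderiv (map_poly of_rat f)) \<gamma> \<noteq> 0"
    using poly_small_nz[OF assms, of "pderiv f"] by (simp add: of_rat_hom.map_poly_pderiv)
  hence "order \<gamma> (pderiv (map_poly of_rat f)) = 0" "pderiv (map_poly of_rat f) \<noteq> (0 :: complex poly)"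
    by (simp add: order_0I, metis poly_0)
  moreover have "order \<gamma> (map_poly of_rat f) \<noteq> 0"
    using assms f_nz by (simp add: roots_C_def order_root)
  ultimately show ?thesis
    using order_pderiv[of "map_poly of_rat f :: complex poly" \<gamma>] assms f_nz
    by (simp add: roots_C_def)
qed

lemma card_roots: "card (roots_C f) = degree f"
proof -
  have "degree f = (\<Sum>z\<in>roots_C f. order z (map_poly of_rat f))"
    using degree_eq_sum_order[of "roots_C f" "map_poly of_rat f"] f_nz finite_roots
    by (simp add: roots_C_def)
  thus ?thesis by (simp add: order_f)
qed

text \<open>A rational polynomial cannot tell conjugate roots apart: each factor \<open>f\<close>
  contributes order one at both of them, and once \<open>f\<close> no longer divides, neither of
  them is a root.\<close>

lemma order_eq:
  assumes "p \<noteq> 0" "\<gamma> \<in> roots_C f" "\<delta> \<in> roots_C f"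
  shows "order \<gamma> (map_poly of_rat p) = order \<delta> (map_poly of_rat p)"
  using assms(1)
proof (induction "degree p" arbitrary: p rule: less_induct)
  case less
  let ?P = "map_poly of_rat :: rat poly \<Rightarrow> complex poly"
  show ?case
  proof (cases "f dvd p")
    case True
    then obtain q where q: "p = f * q" by (elim dvdE)
    have nz: "q \<noteq> 0" using q less.prems by auto
    have "degree q < degree p" using q nz f_nz degree_f_pos by (simp add: degree_mult_eq)
    from less.hyps[OF this nz] show ?thesis
      using q nz f_nz order_f assms by (simp add: of_rat_poly_hom.hom_mult order_mult)
  next
    case False
    hence "poly (?P p) \<gamma> \<noteq> 0" "poly (?P p) \<delta> \<noteq> 0"
      using dvd_if_common_root assms by blast+
    thus ?thesis by (simp add: order_0I)
  qed
qed

text \<open>In effect \<open>p\<close> is a constant multiple of a power of \<open>f\<close>; only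
  the exponent, the common order at all roots, is needed.\<close>

lemma degree_eq_mult_order:
  assumes "p \<noteq> 0" and sub: "{z. poly (map_poly of_rat p) z = 0} \<subseteq> roots_C f"
    and "\<gamma> \<in> roots_C f"
  shows "degree p = order \<gamma> (map_poly of_rat p) * degree f"
proof -
  have "degree p = (\<Sum>z\<in>roots_C f. order z (map_poly of_rat p))"
    using degree_eq_sum_order[OF finite_roots sub] assms(1) by simp
  also have "\<dots> = (\<Sum>z\<in>roots_C f. order \<gamma> (map_poly of_rat p))"
    using assms by (intro sum.cong order_eq) auto
  finally show ?thesis by (simp add: card_roots)
qed

text \<open>Gauss's lemma. \<open>f\<close> divides a monic integer polynomial, so its primitive
  integer multiple \<open>rg\<close> divides it over the integers and has a unit as leading
  coefficient; then \<open>rg\<close> is \<open>f\<close> itself.\<close>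

lemma coeff_Ints:
  assumes "algebraic_int \<beta>\<^sub>0"
  shows "poly.coeff f i \<in> \<int>"
proof -
  obtain p where p: "poly (map_poly of_int p) \<beta>\<^sub>0 = 0" "lead_coeff p = 1"
    using assms unfolding algebraic_int_altdef_ipoly by blast
  have "map_poly of_rat (of_int_poly p) = (of_int_poly p :: complex poly)"
    by (intro poly_eqI) (simp add: coeff_map_poly)
  hence "f dvd of_int_poly p"
    using p min_poly_root by (intro dvd_if_common_root) simp_all
  then obtain h where h: "of_int_poly p = f * h" by (elim dvdE)
  obtain r rg where rg: "rat_to_normalized_int_poly f = (r, rg)" by (metis surj_pair)
  note n = rat_to_normalized_int_poly[OF rg]
  obtain q where "p = rg * q"
    using rat_to_int_factor_explicit[OF h rg] by blast
  hence "lead_coeff rg dvd lead_coeff p" by (simp add: lead_coeff_mult)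
  hence u: "lead_coeff rg dvd 1" using p by simp
  have lc: "r * of_int (lead_coeff rg) = 1"
  proof -
    have "1 = lead_coeff f" using monic_f by simp
    also have "\<dots> = poly.coeff (Polynomial.smult r (of_int_poly rg)) (degree f)"
      by (rule arg_cong[of _ _ "\<lambda>q. poly.coeff q (degree f)", OF n(1)])
    finally show ?thesis using n(4) by simp
  qed
  have "lead_coeff rg = 1 \<or> lead_coeff rg = -1" using u by (auto simp: zdvd1_eq abs_if split: if_splits)
  \<comment> \<open>\<open>n(2)\<close> is the positivity of \<open>r\<close>; it excludes the value
    -1.\<close>
  hence "r = 1" using lc n(2) by auto
  hence "poly.coeff f i = of_int (poly.coeff rg i)"
    using arg_cong[of _ _ "\<lambda>q. poly.coeff q i", OF n(1)] by simp
  thus ?thesis by simp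
qed

end

section \<open>Kronecker products, companion and Vandermonde matrices\<close>

lemma sum_div_mod:
  fixes F :: "nat \<Rightarrow> nat \<Rightarrow> 'a :: comm_monoid_add"
  shows "(\<Sum>l<m * q. F (l div q) (l mod q)) = (\<Sum>a<m. \<Sum>b<q. F a b)"
proof -
  have "(\<Sum>l\<in>{a * q..<a * q + q}. F (l div q) (l mod q)) = (\<Sum>b<q. F a b)" for a
  proof -
    have "l div q = a \<and> l mod q = l - a * q" if "a * q \<le> l" "l < a * q + q" for l
    proof
      show *: "l div q = a" using that by (intro div_nat_eqI) (auto simp: algebra_simps)
      show "l mod q = l - a * q" using * by (metis minus_div_mult_eq_mod)
    qed
    thus ?thesis
      by (intro sum.reindex_bij_witness[of _ "\<lambda>b. a * q + b" "\<lambda>l. l - a * q"]) auto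
  qed
  thus ?thesis by (simp add: sum.nat_group[symmetric])
qed

text \<open>The left factor indexes the blocks and the right factor the positions within a block. So
  \<open>kron (1\<^sub>m N) M\<close> consists of \<open>N\<close> diagonal copies of
  \<open>M\<close>, and \<open>kron T (1\<^sub>m d)\<close> mixes the copies while keeping the
  position.\<close>

definition kron :: "'a :: comm_semiring_1 mat \<Rightarrow> 'a mat \<Rightarrow> 'a mat" where
  "kron A B = mat (dim_row A * dim_row B) (dim_col A * dim_col B)
     (\<lambda>(i, j). A $$ (i div dim_row B, j div dim_col B) * B $$ (i mod dim_row B, j mod dim_col B))"

lemma kron_carrier [simp]:
  "A \<in> carrier_mat n m \<Longrightarrow> B \<in> carrier_mat p q \<Longrightarrow> kron A B \<in> carrier_mat (n * p) (m * q)"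
  by (auto simp: kron_def)

lemma dim_kron [simp]:
  "dim_row (kron A B) = dim_row A * dim_row B" "dim_col (kron A B) = dim_col A * dim_col B"
  by (auto simp: kron_def)

lemma index_kron:
  "A \<in> carrier_mat n m \<Longrightarrow> B \<in> carrier_mat p q \<Longrightarrow> i < n * p \<Longrightarrow> j < m * q \<Longrightarrow>
    kron A B $$ (i, j) = A $$ (i div p, j div q) * B $$ (i mod p, j mod q)"
  by (auto simp: kron_def)

lemma mod_less_mult: "i < n * p \<Longrightarrow> i mod p < (p :: nat)"
  by (cases "p = 0") auto

lemma kron_mult:
  assumes "A \<in> carrier_mat n m" "B \<in> carrier_mat p q" "A' \<in> carrier_mat m k" "B' \<in> carrier_mat q r"
  shows "kron A B * kron A' B' = kron (A * A') (B * B')"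
proof (rule eq_matI)
  show "dim_row (kron A B * kron A' B') = dim_row (kron (A * A') (B * B'))"
    "dim_col (kron A B * kron A' B') = dim_col (kron (A * A') (B * B'))"
    using assms by (auto simp: kron_def)
  fix i j assume "i < dim_row (kron (A * A') (B * B'))" "j < dim_col (kron (A * A') (B * B'))"
  hence ij: "i < n * p" "j < k * r" using assms by (auto simp: kron_def)
  note lt = less_mult_imp_div_less[OF ij(1)] less_mult_imp_div_less[OF ij(2)]
    mod_less_mult[OF ij(1)] mod_less_mult[OF ij(2)]
  have "(kron A B * kron A' B') $$ (i, j) = (\<Sum>l<m * q. kron A B $$ (i, l) * kron A' B' $$ (l, j))"
    using assms ij by (simp add: scalar_prod_def atLeast0LessThan)
  also have "\<dots> = (\<Sum>l<m * q. (A $$ (i div p, l div q) * B $$ (i mod p, l mod q)) *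
      (A' $$ (l div q, j div r) * B' $$ (l mod q, j mod r)))"
    using assms ij by (intro sum.cong refl) (simp add: index_kron[of _ n m _ p q] index_kron[of _ m k _ q r])
  also have "\<dots> = (\<Sum>a<m. \<Sum>b<q. (A $$ (i div p, a) * B $$ (i mod p, b)) *
      (A' $$ (a, j div r) * B' $$ (b, j mod r)))"
    by (rule sum_div_mod)
  also have "\<dots> = (\<Sum>a<m. A $$ (i div p, a) * A' $$ (a, j div r)) *
      (\<Sum>b<q. B $$ (i mod p, b) * B' $$ (b, j mod r))"
    by (simp add: sum_product mult_ac)
  also have "\<dots> = (A * A') $$ (i div p, j div r) * (B * B') $$ (i mod p, j mod r)"
    using assms lt by (auto simp: scalar_prod_def atLeast0LessThan)
  also have "\<dots> = kron (A * A') (B * B') $$ (i, j)"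
    using assms ij by (subst index_kron[of _ n k _ p r]) auto
  finally show "(kron A B * kron A' B') $$ (i, j) = kron (A * A') (B * B') $$ (i, j)" .
qed

lemma kron_one: "kron (1\<^sub>m n) (1\<^sub>m d) = 1\<^sub>m (n * d)"
proof (rule eq_matI)
  fix i j assume "i < dim_row (1\<^sub>m (n * d) :: 'a mat)" "j < dim_col (1\<^sub>m (n * d) :: 'a mat)"
  hence ij: "i < n * d" "j < n * d" by auto
  have "i = j \<longleftrightarrow> i div d = j div d \<and> i mod d = j mod d"
    by (metis div_mult_mod_eq)
  thus "kron (1\<^sub>m n) (1\<^sub>m d) $$ (i, j) = (1\<^sub>m (n * d) :: 'a mat) $$ (i, j)"
    using ij less_mult_imp_div_less[OF ij(1)] less_mult_imp_div_less[OF ij(2)]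
      mod_less_mult[OF ij(1)] mod_less_mult[OF ij(2)]
    by (subst index_kron[of _ n n _ d d]) auto
qed (auto simp: kron_def)

lemma kron_one_left: "B \<in> carrier_mat p q \<Longrightarrow> kron (1\<^sub>m 1) B = B"
  by (rule eq_matI) (auto simp: kron_def)

lemma (in comm_ring_hom) kron_hom:
  "A \<in> carrier_mat n m \<Longrightarrow> B \<in> carrier_mat p q \<Longrightarrow>
    map_mat hom (kron A B) = kron (map_mat hom A) (map_mat hom B)"
  by (rule eq_matI)
    (auto simp: kron_def hom_mult less_mult_imp_div_less mod_less_mult)

text \<open>Multiplication by x on polynomials modulo a monic \<open>f\<close>, in the basis of the
  powers of x; column \<open>j\<close> holds the coordinates of x^(j+1).\<close>

definition companion :: "'a :: comm_ring_1 poly \<Rightarrow> 'a mat" where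
  "companion f = mat (degree f) (degree f)
     (\<lambda>(i, j). if Suc j < degree f then of_bool (i = Suc j) else - poly.coeff f i)"

lemma companion_carrier [simp]: "companion f \<in> carrier_mat (degree f) (degree f)"
  by (simp add: companion_def)

lemma (in inj_comm_ring_hom) companion_hom: "map_mat hom (companion f) = companion (map_poly hom f)"
  by (rule eq_matI) (auto simp: companion_def hom_uminus)

definition vandermonde :: "nat \<Rightarrow> (nat \<Rightarrow> 'a :: comm_ring_1) \<Rightarrow> 'a mat" where
  "vandermonde d \<beta> = mat d d (\<lambda>(a, l). \<beta> a ^ l)"

lemma vandermonde_carrier [simp]: "vandermonde d \<beta> \<in> carrier_mat d d"
  by (simp add: vandermonde_def)

text \<open>Row \<open>a\<close> evaluates a polynomial at \<open>\<beta> a\<close>, which turns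
  multiplication by x modulo \<open>f\<close> into multiplication by \<open>\<beta> a\<close>. Only
  the last column uses that \<open>\<beta> a\<close> is a root.\<close>

lemma vandermonde_companion:
  fixes f :: "'a :: comm_ring_1 poly"
  assumes "lead_coeff f = 1" and roots: "\<And>a. a < degree f \<Longrightarrow> poly f (\<beta> a) = 0"
  shows "vandermonde (degree f) \<beta> * companion f = mat_diag (degree f) \<beta> * vandermonde (degree f) \<beta>"
proof (rule eq_matI)
  let ?d = "degree f"
  fix i j
  assume "i < dim_row (mat_diag ?d \<beta> * vandermonde ?d \<beta>)" "j < dim_col (mat_diag ?d \<beta> * vandermonde ?d \<beta>)"
  hence ij: "i < ?d" "j < ?d" by (simp_all add: vandermonde_def mat_diag_def)
  have "(vandermonde ?d \<beta> * companion f) $$ (i, j) =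
      (\<Sum>l<?d. \<beta> i ^ l * (if Suc j < ?d then of_bool (l = Suc j) else - poly.coeff f l))"
    using ij by (auto simp: vandermonde_def companion_def scalar_prod_def atLeast0LessThan intro!: sum.cong)
  also have "\<dots> = \<beta> i ^ Suc j"
  proof (cases "Suc j < ?d")
    case True
    thus ?thesis by simp
  next
    case False
    hence j: "Suc j = ?d" using ij by simp
    have "0 = (\<Sum>l\<le>?d. poly.coeff f l * \<beta> i ^ l)"
      using roots[OF ij(1)] by (simp add: poly_altdef)
    also have "\<dots> = (\<Sum>l<?d. poly.coeff f l * \<beta> i ^ l) + \<beta> i ^ ?d"
      using assms(1) by (simp add: lessThan_Suc_atMost[symmetric])
    finally have "\<beta> i ^ ?d = - (\<Sum>l<?d. poly.coeff f l * \<beta> i ^ l)"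
      by (simp add: eq_neg_iff_add_eq_0 add.commute)
    thus ?thesis using j by (simp add: sum_negf[symmetric] mult.commute)
  qed
  also have "\<dots> = (mat_diag ?d \<beta> * vandermonde ?d \<beta>) $$ (i, j)"
    using ij by (subst mat_diag_mult_left[of _ _ ?d]) (auto simp: vandermonde_def)
  finally show "(vandermonde ?d \<beta> * companion f) $$ (i, j) = (mat_diag ?d \<beta> * vandermonde ?d \<beta>) $$ (i, j)" .
qed (simp_all add: vandermonde_def companion_def mat_diag_def)

definition poly_of_vec :: "'a :: comm_semiring_1 vec \<Rightarrow> 'a poly" where
  "poly_of_vec v = (\<Sum>l<dim_vec v. monom (v $ l) l)"

lemma coeff_poly_of_vec: "poly.coeff (poly_of_vec v) l = (if l < dim_vec v then v $ l else 0)"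
  by (simp add: poly_of_vec_def coeff_sum sum.delta)

lemma poly_poly_of_vec: "poly (poly_of_vec v) x = (\<Sum>l<dim_vec v. v $ l * x ^ l)"
  by (simp add: poly_of_vec_def poly_sum Polynomial.poly_monom)

lemma degree_poly_of_vec: "dim_vec v > 0 \<Longrightarrow> degree (poly_of_vec v) < dim_vec v"
  by (intro degree_lessI) (auto simp: coeff_poly_of_vec)

lemma poly_of_vec_nz: "v \<in> carrier_vec d \<Longrightarrow> v \<noteq> 0\<^sub>v d \<Longrightarrow> poly_of_vec v \<noteq> 0"
  by (metis carrier_vecD coeff_0 coeff_poly_of_vec eq_vecI index_zero_vec)

text \<open>A kernel vector would be a non-zero polynomial of degree below \<open>d\<close> with
  \<open>d\<close> distinct roots.\<close>

lemma det_vandermonde_nz: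
  fixes \<beta> :: "nat \<Rightarrow> 'a :: field"
  assumes "inj_on \<beta> {..<d}"
  shows "det (vandermonde d \<beta>) \<noteq> 0"
proof
  assume "det (vandermonde d \<beta>) = 0"
  then obtain v where v: "v \<in> carrier_vec d" "v \<noteq> 0\<^sub>v d" "vandermonde d \<beta> *\<^sub>v v = 0\<^sub>v d"
    using det_0_iff_vec_prod_zero_field[OF vandermonde_carrier] by blast
  have "d > 0" using v by (cases d) auto
  have "poly (poly_of_vec v) (\<beta> a) = 0" if "a < d" for a
  proof -
    have "(vandermonde d \<beta> *\<^sub>v v) $ a = (\<Sum>l<d. \<beta> a ^ l * v $ l)"
      using that v(1) by (simp add: vandermonde_def scalar_prod_def atLeast0LessThan)
    thus ?thesis using v(1,3) that by (simp add: poly_poly_of_vec mult.commute)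
  qed
  hence "\<beta> ` {..<d} \<subseteq> {x. poly (poly_of_vec v) x = 0}" by auto
  hence "d \<le> card {x. poly (poly_of_vec v) x = 0}"
    using poly_roots_finite[OF poly_of_vec_nz[OF v(1,2)]] assms
    by (metis card_image card_lessThan card_mono)
  also have "\<dots> \<le> degree (poly_of_vec v)"
    using poly_of_vec_nz[OF v(1,2)] by (intro card_poly_roots_bound)
  also have "\<dots> < d" using degree_poly_of_vec[of v] v(1) \<open>d > 0\<close> by simp
  finally show False by simp
qed

lemma intertwine_pow:
  fixes X :: "'a :: comm_ring_1 mat"
  assumes "B \<in> carrier_mat k k" "X \<in> carrier_mat k s" "C \<in> carrier_mat s s" "B * X = X * C"
  shows "B ^\<^sub>m m * X = X * C ^\<^sub>m m"
proof (induction m)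
  case (Suc m)
  have "B ^\<^sub>m Suc m * X = B ^\<^sub>m m * (B * X)"
    using assms by (simp add: assoc_mult_mat[OF pow_carrier_mat])
  also have "\<dots> = B ^\<^sub>m m * X * C"
    using assms(1-3) by (simp add: assms(4) assoc_mult_mat[OF pow_carrier_mat[OF assms(1)], symmetric])
  also have "\<dots> = X * C ^\<^sub>m Suc m"
    using assms by (simp add: Suc assoc_mult_mat[of _ k s _ s _ s])
  finally show ?case .
qed (use assms in auto)

section \<open>Cyclic vectors of the companion matrix\<close>

text \<open>The Krylov matrix of \<open>p\<close>, with columns p, Mp, M^2 p and so on. It is
  non-singular exactly if \<open>p\<close> is a cyclic vector, so cyclicity is expressed by a
  determinant, which passes from the rationals to the reals.\<close>

definition cyclic_mat :: "'a :: comm_ring_1 mat \<Rightarrow> 'a vec \<Rightarrow> 'a mat" where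
  "cyclic_mat M p = mat (dim_row M) (dim_row M) (\<lambda>(i, k). (M ^\<^sub>m k *\<^sub>v p) $ i)"

lemma cyclic_mat_carrier [simp]: "M \<in> carrier_mat d d \<Longrightarrow> cyclic_mat M p \<in> carrier_mat d d"
  by (auto simp: cyclic_mat_def)

lemma dim_cyclic_mat [simp]:
  "dim_row (cyclic_mat M p) = dim_row M" "dim_col (cyclic_mat M p) = dim_row M"
  by (simp_all add: cyclic_mat_def)

lemma col_cyclic_mat:
  "M \<in> carrier_mat d d \<Longrightarrow> k < d \<Longrightarrow> col (cyclic_mat M p) k = M ^\<^sub>m k *\<^sub>v p"
  by (rule eq_vecI) (auto simp: cyclic_mat_def)

lemma pow_mult_commute: "(M :: 'a :: comm_ring_1 mat) \<in> carrier_mat d d \<Longrightarrow> M ^\<^sub>m k * M = M * M ^\<^sub>m k"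
  using intertwine_pow[of M d M d M k] by simp

lemma mat_diag_mult_vec:
  "v \<in> carrier_vec d \<Longrightarrow> mat_diag d w *\<^sub>v v = vec d (\<lambda>i. w i * v $ i)"
proof (intro eq_vecI)
  fix i assume "v \<in> carrier_vec d" "i < dim_vec (vec d (\<lambda>i. w i * v $ i))"
  hence i: "v \<in> carrier_vec d" "i < d" by auto
  have "(mat_diag d w *\<^sub>v v) $ i = (\<Sum>j<d. (if i = j then w j else 0) * v $ j)"
    using i by (simp add: mat_diag_def scalar_prod_def atLeast0LessThan)
  also have "\<dots> = (\<Sum>j<d. if j = i then w i * v $ i else 0)"
    by (intro sum.cong) auto
  finally have "(mat_diag d w *\<^sub>v v) $ i = (\<Sum>j<d. if j = i then w i * v $ i else 0)" .
  thus "(mat_diag d w *\<^sub>v v) $ i = vec d (\<lambda>i. w i * v $ i) $ i" using i by simp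
qed (simp add: mat_diag_def)

lemma mat_diag_pow: "mat_diag d w ^\<^sub>m k = mat_diag d (\<lambda>i. w i ^ k :: 'a :: comm_semiring_1)"
  by (induction k) (simp_all add: mult.commute, simp add: mat_diag_def)

lemma (in comm_ring_hom) cyclic_mat_hom:
  assumes "M \<in> carrier_mat d d" "p \<in> carrier_vec d"
  shows "map_mat hom (cyclic_mat M p) = cyclic_mat (map_mat hom M) (map_vec hom p)"
proof (rule eq_matI)
  fix i k
  assume "i < dim_row (cyclic_mat (map_mat hom M) (map_vec hom p))"
    "k < dim_col (cyclic_mat (map_mat hom M) (map_vec hom p))"
  hence ik: "i < d" "k < d" using assms by (auto simp: cyclic_mat_def)
  have "map_mat hom M ^\<^sub>m k *\<^sub>v map_vec hom p = map_vec hom (M ^\<^sub>m k *\<^sub>v p)"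
    using assms by (simp add: mat_hom_pow mult_mat_vec_hom[OF pow_carrier_mat])
  moreover have "i < dim_vec (M ^\<^sub>m k *\<^sub>v p)" using assms ik by simp
  ultimately have "(map_mat hom M ^\<^sub>m k *\<^sub>v map_vec hom p) $ i = hom ((M ^\<^sub>m k *\<^sub>v p) $ i)"
    by (simp only: index_map_vec)
  thus "map_mat hom (cyclic_mat M p) $$ (i, k) = cyclic_mat (map_mat hom M) (map_vec hom p) $$ (i, k)"
    using assms ik by (simp add: cyclic_mat_def del: index_mult_mat_vec)
qed (simp_all add: cyclic_mat_def)

text \<open>The kernel of \<open>R\<close> is invariant under \<open>M\<close> because
  \<open>R\<close> intertwines; containing a cyclic vector, it is everything.\<close>

lemma cyclic_mat_kernel:
  fixes M :: "'a :: field mat"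
  assumes M: "M \<in> carrier_mat d d" and R: "R \<in> carrier_mat k d" and B: "B \<in> carrier_mat k k"
    and RM: "B * R = R * M" and p: "p \<in> carrier_vec d" "R *\<^sub>v p = 0\<^sub>v k"
    and det: "det (cyclic_mat M p) \<noteq> 0"
  shows "R = 0\<^sub>m k d"
proof -
  let ?P = "cyclic_mat M p"
  have P: "?P \<in> carrier_mat d d" using M by simp
  have "col (R * ?P) l = 0\<^sub>v k" if "l < d" for l
  proof -
    have "col (R * ?P) l = R *\<^sub>v (M ^\<^sub>m l *\<^sub>v p)"
      using that by (simp add: col_mult2[OF R P] col_cyclic_mat[OF M])
    also have "\<dots> = R * M ^\<^sub>m l *\<^sub>v p"
      using assoc_mult_mat_vec[OF R pow_carrier_mat[OF M] p(1)] by simp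
    also have "\<dots> = B ^\<^sub>m l * R *\<^sub>v p"
      by (simp add: intertwine_pow[OF B R M RM])
    also have "\<dots> = B ^\<^sub>m l *\<^sub>v 0\<^sub>v k"
      using assoc_mult_mat_vec[OF pow_carrier_mat[OF B] R p(1)] p(2) by simp
    also have "\<dots> = 0\<^sub>v k"
      using pow_carrier_mat[OF B, of l] by (intro eq_vecI) (auto simp: scalar_prod_def)
    finally show ?thesis .
  qed
  hence RP: "R * ?P = 0\<^sub>m k d"
    using R P by (intro mat_col_eqI) auto
  obtain Q where Q: "Q \<in> carrier_mat d d" "?P * Q = 1\<^sub>m d"
    using det_non_zero_imp_unit[OF P det] by (auto simp: Units_def ring_mat_def)
  have "R = R * (?P * Q)" using R Q by simp
  also have "\<dots> = R * ?P * Q" using R P Q(1) by (simp add: assoc_mult_mat[of _ k d _ d _ d])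
  also have "\<dots> = 0\<^sub>m k d" using RP Q by simp
  finally show ?thesis .
qed

lemma transpose_pow_scalar_prod:
  fixes M :: "'a :: comm_ring_1 mat"
  assumes M: "M \<in> carrier_mat d d" and "q \<in> carrier_vec d" "p \<in> carrier_vec d"
  shows "(transpose_mat M ^\<^sub>m k *\<^sub>v q) \<bullet> p = q \<bullet> (M ^\<^sub>m k *\<^sub>v p)"
  using assms(2)
proof (induction k arbitrary: q)
  case 0
  thus ?case using M assms(3) by simp
next
  case (Suc k)
  have MT: "transpose_mat M \<in> carrier_mat d d" using M by simp
  have v: "transpose_mat M *\<^sub>v q \<in> carrier_vec d" using MT Suc.prems by simp
  have "(transpose_mat M ^\<^sub>m Suc k *\<^sub>v q) = transpose_mat M ^\<^sub>m k *\<^sub>v (transpose_mat M *\<^sub>v q)"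
    using assoc_mult_mat_vec[OF pow_carrier_mat[OF MT] MT Suc.prems] by simp
  hence "(transpose_mat M ^\<^sub>m Suc k *\<^sub>v q) \<bullet> p = (transpose_mat M *\<^sub>v q) \<bullet> (M ^\<^sub>m k *\<^sub>v p)"
    using Suc.IH[OF v] by simp
  also have "\<dots> = q \<bullet> (M *\<^sub>v (M ^\<^sub>m k *\<^sub>v p))"
    using Suc.prems mult_mat_vec_carrier[OF pow_carrier_mat[OF M] assms(3)]
    by (intro transpose_vec_mult_scalar[OF M]) auto
  also have "M *\<^sub>v (M ^\<^sub>m k *\<^sub>v p) = M ^\<^sub>m Suc k *\<^sub>v p"
    using assoc_mult_mat_vec[OF M pow_carrier_mat[OF M] assms(3)] pow_mult_commute[OF M] by simp
  finally show ?case .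
qed

context min_poly_Q
begin

definition rt :: "nat \<Rightarrow> complex" where
  "rt = (SOME b. bij_betw b {..<degree f} (roots_C f))"

lemma bij_rt: "bij_betw rt {..<degree f} (roots_C f)"
proof -
  have "\<exists>b. bij_betw b {..<degree f} (roots_C f)"
    using ex_bij_betw_nat_finite[OF finite_roots] card_roots by (simp add: atLeast0LessThan)
  thus ?thesis unfolding rt_def by (rule someI_ex)
qed

lemma rt_root: "a < degree f \<Longrightarrow> rt a \<in> roots_C f"
  using bij_rt by (auto simp: bij_betw_def)

lemma vandermonde_rt:
  "vandermonde (degree f) rt * companion (map_poly of_rat f) = mat_diag (degree f) rt * vandermonde (degree f) rt"
proof -
  have "lead_coeff (map_poly of_rat f :: complex poly) = 1" using monic_f by simp
  from vandermonde_companion[OF this, of rt] show ?thesis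
    using rt_root by (simp add: roots_C_def)
qed

lemma det_vandermonde_rt: "det (vandermonde (degree f) rt) \<noteq> 0"
  using bij_rt by (intro det_vandermonde_nz) (auto simp: bij_betw_def)

text \<open>The product of the Vandermonde matrix V and the Krylov matrix is a diagonal matrix times
  V. The diagonal entries are the values, at the roots of \<open>f\<close>, of the polynomial with
  coefficients \<open>p\<close>; none of them vanishes, since that polynomial is rational and of
  smaller degree than \<open>f\<close>. For real \<open>p\<close> this may fail.\<close>

lemma det_cyclic_companion:
  assumes p: "p \<in> carrier_vec (degree f)" "p \<noteq> 0\<^sub>v (degree f)"
  shows "det (cyclic_mat (companion f) p) \<noteq> 0"
proof -
  let ?d = "degree f" and ?c = "of_rat :: rat \<Rightarrow> complex"
  let ?V = "vandermonde ?d rt" and ?C = "companion (map_poly of_rat f :: complex poly)" 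
  let ?p = "map_vec ?c p"
  define w where "w a = poly (map_poly ?c (poly_of_vec p)) (rt a)" for a
  have C: "?C \<in> carrier_mat ?d ?d" using companion_carrier[of "map_poly ?c f"] by simp
  have V: "?V \<in> carrier_mat ?d ?d" by simp
  have pc: "?p \<in> carrier_vec ?d" using p by simp
  have D: "mat_diag ?d rt \<in> carrier_mat ?d ?d" by simp
  have Vp: "?V *\<^sub>v ?p = vec ?d w"
  proof (rule eq_vecI)
    fix a assume "a < dim_vec (vec ?d w)"
    hence a: "a < ?d" by simp
    have "map_poly ?c (poly_of_vec p) = poly_of_vec ?p"
      by (intro poly_eqI) (simp add: coeff_poly_of_vec)
    thus "(?V *\<^sub>v ?p) $ a = vec ?d w $ a"
      using a p by (simp add: w_def poly_poly_of_vec vandermonde_def scalar_prod_def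
          atLeast0LessThan mult.commute)
  qed (simp add: vandermonde_def)
  have "?V * cyclic_mat ?C ?p = mat_diag ?d w * ?V"
  proof (rule mat_col_eqI)
    fix k assume "k < dim_col (mat_diag ?d w * ?V)"
    hence k: "k < ?d" by (simp add: vandermonde_def)
    have "col (?V * cyclic_mat ?C ?p) k = ?V *\<^sub>v (?C ^\<^sub>m k *\<^sub>v ?p)"
      using k col_mult2[OF V cyclic_mat_carrier[OF C]] col_cyclic_mat[OF C] by simp
    also have "\<dots> = mat_diag ?d rt ^\<^sub>m k *\<^sub>v (?V *\<^sub>v ?p)"
      using intertwine_pow[OF D V C vandermonde_rt[symmetric], of k]
        assoc_mult_mat_vec[OF V pow_carrier_mat[OF C, of k] pc]
        assoc_mult_mat_vec[OF pow_carrier_mat[OF D, of k] V pc] by metis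
    also have "\<dots> = col (mat_diag ?d w * ?V) k"
      using k unfolding Vp mat_diag_pow by (intro eq_vecI)
       (auto simp: mat_diag_mult_left[of _ ?d ?d] mat_diag_mult_vec vandermonde_def mult.commute)
    finally show "col (?V * cyclic_mat ?C ?p) k = col (mat_diag ?d w * ?V) k" .
  qed (use C in \<open>auto simp: vandermonde_def cyclic_mat_def mat_diag_def\<close>)
  hence "det ?V * det (cyclic_mat ?C ?p) = det (mat_diag ?d w) * det ?V"
    using det_mult[OF V cyclic_mat_carrier[OF C], of ?p] det_mult[OF mat_diag_dim V, of w] by auto
  moreover have "det (mat_diag ?d w) = (\<Prod>a<?d. w a)"
  proof -
    have "det (mat_diag ?d w) = prod_list (diag_mat (mat_diag ?d w))"
      by (intro det_upper_triangular[of _ ?d]) (auto simp: mat_diag_def upper_triangular_def)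
    also have "diag_mat (mat_diag ?d w) = map w [0..<?d]"
      by (auto simp: diag_mat_def mat_diag_def)
    finally show ?thesis by (simp add: prod.list_conv_set_nth atLeast0LessThan)
  qed
  moreover have "w a \<noteq> 0" if "a < ?d" for a
    unfolding w_def using that p degree_f_pos degree_poly_of_vec[of p]
    by (intro poly_small_nz rt_root poly_of_vec_nz) auto
  ultimately have "det (cyclic_mat ?C ?p) \<noteq> 0" using det_vandermonde_rt by auto
  moreover have "cyclic_mat ?C ?p = map_mat ?c (cyclic_mat (companion f) p)"
    using p by (simp add: of_rat_hom.cyclic_mat_hom[OF companion_carrier] of_rat_hom.companion_hom)
  ultimately show ?thesis by (simp add: of_rat_hom.hom_det)
qed

text \<open>Were \<open>q\<close> not cyclic for the transpose, some non-zero rational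
  \<open>p\<close> would be orthogonal to its whole orbit. Moving the powers to the other side makes
  \<open>q\<close> orthogonal to the orbit of \<open>p\<close>, which contradicts that
  \<open>p\<close> is cyclic.\<close>

lemma det_cyclic_companion_transpose:
  assumes q: "q \<in> carrier_vec (degree f)" "q \<noteq> 0\<^sub>v (degree f)"
  shows "det (cyclic_mat (transpose_mat (companion f)) q) \<noteq> 0"
proof
  let ?d = "degree f" and ?C = "companion f"
  let ?P = "\<lambda>p. cyclic_mat ?C p" and ?Q = "cyclic_mat (transpose_mat ?C) q"
  have C: "?C \<in> carrier_mat ?d ?d" and CT: "transpose_mat ?C \<in> carrier_mat ?d ?d"
    and [simp]: "dim_row ?C = ?d" "dim_col ?C = ?d"
    and QT: "transpose_mat ?Q \<in> carrier_mat ?d ?d" and Q: "?Q \<in> carrier_mat ?d ?d" by (auto simp: companion_def)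
  assume "det ?Q = 0"
  hence "det (transpose_mat ?Q) = 0" by (simp add: det_transpose[OF Q])
  then obtain p where p: "p \<in> carrier_vec ?d" "p \<noteq> 0\<^sub>v ?d" "transpose_mat ?Q *\<^sub>v p = 0\<^sub>v ?d"
    using det_0_iff_vec_prod_zero_field[OF QT] by blast
  have P: "?P p \<in> carrier_mat ?d ?d" by simp
  have "(transpose_mat (?P p) *\<^sub>v q) $ k = 0" if k: "k < ?d" for k
  proof -
    have "(transpose_mat (?P p) *\<^sub>v q) $ k = (?C ^\<^sub>m k *\<^sub>v p) \<bullet> q"
      using k P col_cyclic_mat[OF C k, of p] by simp
    also have "\<dots> = (transpose_mat ?C ^\<^sub>m k *\<^sub>v q) \<bullet> p"
      using transpose_pow_scalar_prod[OF C q(1) p(1), of k]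
        comm_scalar_prod[OF q(1) mult_mat_vec_carrier[OF pow_carrier_mat[OF C] p(1), of k]] by simp
    also have "\<dots> = (transpose_mat ?Q *\<^sub>v p) $ k"
      using k Q col_cyclic_mat[OF CT k, of q] by simp
    finally show ?thesis using p k by simp
  qed
  hence "transpose_mat (?P p) *\<^sub>v q = 0\<^sub>v ?d" using P by (intro eq_vecI) auto
  hence "det (transpose_mat (?P p)) = 0"
    using det_0_iff_vec_prod_zero_field[of "transpose_mat (?P p)" ?d] q by auto
  thus False using det_cyclic_companion[OF p(1,2)] by (simp add: det_transpose[OF P])
qed

end

section \<open>Completing a right inverse\<close>

lemma sum_diag_mult_commute:
  fixes A B :: "'a :: comm_semiring_0 mat"
  assumes "A \<in> carrier_mat n m" "B \<in> carrier_mat m n"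
  shows "(\<Sum>i<n. (A * B) $$ (i, i)) = (\<Sum>j<m. (B * A) $$ (j, j))"
proof -
  have "(\<Sum>i<n. (A * B) $$ (i, i)) = (\<Sum>i<n. \<Sum>j<m. A $$ (i, j) * B $$ (j, i))"
    using assms by (simp add: scalar_prod_def atLeast0LessThan)
  also have "\<dots> = (\<Sum>j<m. \<Sum>i<n. B $$ (j, i) * A $$ (i, j))"
    by (subst sum.swap) (simp add: mult.commute)
  also have "\<dots> = (\<Sum>j<m. (B * A) $$ (j, j))"
    using assms by (simp add: scalar_prod_def atLeast0LessThan)
  finally show ?thesis .
qed

definition append_cols :: "'a :: zero mat \<Rightarrow> 'a mat \<Rightarrow> 'a mat" where
  "append_cols A B = four_block_mat A B (0\<^sub>m 0 (dim_col A)) (0\<^sub>m 0 (dim_col B))"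

lemma append_cols_carrier [simp]:
  "A \<in> carrier_mat n m \<Longrightarrow> B \<in> carrier_mat n k \<Longrightarrow> append_cols A B \<in> carrier_mat n (m + k)"
  by (auto simp: append_cols_def)

lemma mult_zero_dim [simp]:
  "A \<in> carrier_mat n 0 \<Longrightarrow> B \<in> carrier_mat 0 m \<Longrightarrow> A * B = (0\<^sub>m n m :: 'a :: comm_ring_1 mat)"
  by (rule eq_matI) (auto simp: scalar_prod_def)

lemma append_rows_mult:
  fixes A B X :: "'a :: comm_ring_1 mat"
  assumes "A \<in> carrier_mat n s" "B \<in> carrier_mat k s" "X \<in> carrier_mat s m"
  shows "(A @\<^sub>r B) * X = (A * X) @\<^sub>r (B * X)"
proof -
  have "X = four_block_mat X (0\<^sub>m s 0) (0\<^sub>m 0 m) (0\<^sub>m 0 0)"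
    using assms by (intro eq_matI) auto
  hence "(A @\<^sub>r B) * X = (A @\<^sub>r B) * \<dots>" by simp
  also have "\<dots> = (A * X) @\<^sub>r (B * X)"
    unfolding append_rows_def using assms
    by (subst mult_four_block_mat[of _ n s _ 0 _ k _ _ m _ 0]) auto
  finally show ?thesis .
qed

lemma mult_append_cols:
  fixes A B X :: "'a :: comm_ring_1 mat"
  assumes "A \<in> carrier_mat s n" "B \<in> carrier_mat s k" "X \<in> carrier_mat m s"
  shows "X * append_cols A B = append_cols (X * A) (X * B)"
proof -
  have "X = four_block_mat X (0\<^sub>m m 0) (0\<^sub>m 0 s) (0\<^sub>m 0 0)"
    using assms by (intro eq_matI) auto
  hence "X * append_cols A B = \<dots> * append_cols A B" by simp
  also have "\<dots> = append_cols (X * A) (X * B)"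
    unfolding append_cols_def using assms
    by (subst mult_four_block_mat[of _ m s _ 0 _ 0 _ _ n _ k]) auto
  finally show ?thesis .
qed

lemma append_cols_mult_append_rows:
  fixes A B C D :: "'a :: comm_ring_1 mat"
  assumes "A \<in> carrier_mat s n" "B \<in> carrier_mat s k" "C \<in> carrier_mat n m" "D \<in> carrier_mat k m"
  shows "append_cols A B * (C @\<^sub>r D) = A * C + B * D"
proof -
  have "append_cols A B * (C @\<^sub>r D) =
      four_block_mat (A * C + B * D) (0\<^sub>m s 0) (0\<^sub>m 0 m) (0\<^sub>m 0 0)"
    unfolding append_rows_def append_cols_def using assms
    by (subst mult_four_block_mat[of _ s n _ k _ 0 _ _ m _ 0]) auto
  also have "\<dots> = A * C + B * D"
    using assms by (intro eq_matI) auto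
  finally show ?thesis .
qed

lemma append_rows_mult_append_cols:
  fixes A B C D :: "'a :: comm_ring_1 mat"
  assumes "A \<in> carrier_mat n s" "B \<in> carrier_mat k s" "C \<in> carrier_mat s p" "D \<in> carrier_mat s q"
  shows "(A @\<^sub>r B) * append_cols C D = four_block_mat (A * C) (A * D) (B * C) (B * D)"
  unfolding append_rows_def append_cols_def using assms
  by (subst mult_four_block_mat[of _ n s _ 0 _ k _ _ p _ q]) auto

lemma four_block_inj:
  assumes "four_block_mat A B C D = four_block_mat A' B' C' D'"
    "A \<in> carrier_mat n m" "B \<in> carrier_mat n k" "C \<in> carrier_mat p m" "D \<in> carrier_mat p k"
    "A' \<in> carrier_mat n m" "B' \<in> carrier_mat n k" "C' \<in> carrier_mat p m" "D' \<in> carrier_mat p k"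
  shows "A = A'" "B = B'" "C = C'" "D = D'"
proof -
  have e: "four_block_mat A B C D $$ (i, j) = four_block_mat A' B' C' D' $$ (i, j)" for i j
    using assms(1) by simp
  show "A = A'" 
  proof (rule eq_matI)
    fix i j assume "i < dim_row A'" "j < dim_col A'"
    thus "A $$ (i, j) = A' $$ (i, j)" using e[of i j] assms(2-) by auto
  qed (use assms in auto)
  show "B = B'" 
  proof (rule eq_matI)
    fix i j assume "i < dim_row B'" "j < dim_col B'"
    thus "B $$ (i, j) = B' $$ (i, j)" using e[of i "j + m"] assms(2-) by auto
  qed (use assms in auto)
  show "C = C'" 
  proof (rule eq_matI)
    fix i j assume "i < dim_row C'" "j < dim_col C'"
    thus "C $$ (i, j) = C' $$ (i, j)" using e[of "i + n" j] assms(2-) by auto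
  qed (use assms in auto)
  show "D = D'" 
  proof (rule eq_matI)
    fix i j assume "i < dim_row D'" "j < dim_col D'"
    thus "D $$ (i, j) = D' $$ (i, j)" using e[of "i + n" "j + m"] assms(2-) by auto
  qed (use assms in auto)
qed

lemma append_rows_inj:
  assumes "A @\<^sub>r B = A' @\<^sub>r B'" "A \<in> carrier_mat n m" "B \<in> carrier_mat k m"
    "A' \<in> carrier_mat n m" "B' \<in> carrier_mat k m"
  shows "A = A'" "B = B'"
  using four_block_inj[OF assms(1)[unfolded append_rows_def], of n m 0 k] assms(2-) by auto

lemma append_cols_inj:
  assumes "append_cols A B = append_cols A' B'" "A \<in> carrier_mat n m" "B \<in> carrier_mat n k"
    "A' \<in> carrier_mat n m" "B' \<in> carrier_mat n k"
  shows "A = A'" "B = B'"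
  using four_block_inj[OF assms(1)[unfolded append_cols_def], of n m k 0] assms(2-) by auto

lemma zero_append_rows: "(0\<^sub>m n m @\<^sub>r 0\<^sub>m k m :: 'a :: zero mat) = 0\<^sub>m (n + k) m"
  by (rule eq_matI) (auto simp: append_rows_def)

lemma zero_append_cols: "append_cols (0\<^sub>m n m) (0\<^sub>m n k) = (0\<^sub>m n (m + k) :: 'a :: zero mat)"
  by (rule eq_matI) (auto simp: append_cols_def)

text \<open>\<open>S * P\<close> is a projection of rank n, and the claim supplies bases for its
  complement, which make \<open>P @\<^sub>r Z\<close> and \<open>append_cols S Y\<close> inverse to
  each other. The induction adds one row and one column at a time, read off from the complementary
  idempotent \<open>E\<close>; a trace argument shows that \<open>E\<close> is non-zero while n <
  s.\<close>

lemma right_inverse_complement: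
  fixes P S :: "'a :: field_char_0 mat"
  assumes "P \<in> carrier_mat n s" "S \<in> carrier_mat s n" "P * S = 1\<^sub>m n" "n \<le> s"
  shows "\<exists>Z Y. Z \<in> carrier_mat (s - n) s \<and> Y \<in> carrier_mat s (s - n) \<and> P * Y = 0\<^sub>m n (s - n) \<and>
    Z * S = 0\<^sub>m (s - n) n \<and> Z * Y = 1\<^sub>m (s - n) \<and> S * P + Y * Z = 1\<^sub>m s"
  using assms
proof (induction "s - n" arbitrary: n P S)
  case 0
  hence "n = s" by simp
  moreover have "S * P = 1\<^sub>m s"
    using 0 \<open>n = s\<close> mat_mult_left_right_inverse[of P s S] by simp
  ultimately show ?case using 0
    by (intro exI[of _ "0\<^sub>m 0 s"] exI[of _ "0\<^sub>m s 0"]) (auto intro!: eq_matI)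
next
  case (Suc m)
  note P = Suc.prems(1) and S = Suc.prems(2)
  define E where "E = 1\<^sub>m s - S * P"
  have E: "E \<in> carrier_mat s s"
    unfolding E_def using mult_carrier_mat[OF S P] by (rule minus_carrier_mat)
  have SP: "S * P \<in> carrier_mat s s" using P S by simp
  have PE: "P * E = 0\<^sub>m n s"
  proof -
    have "P * E = P * 1\<^sub>m s - P * (S * P)"
      unfolding E_def by (rule mult_minus_distrib_mat[OF P _ SP]) simp
    also have "P * (S * P) = P" using assoc_mult_mat[OF P S P] Suc.prems(3) P by simp
    finally show ?thesis using P by simp
  qed
  have ES: "E * S = 0\<^sub>m s n"
  proof -
    have "E * S = 1\<^sub>m s * S - S * P * S"
      unfolding E_def by (rule minus_mult_distrib_mat[OF _ SP S]) simp
    also have "S * P * S = S" using assoc_mult_mat[OF S P S] Suc.prems(3) S by simp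
    finally show ?thesis using S by simp
  qed
  have EE: "E * E = E"
  proof -
    have "E * E = E * 1\<^sub>m s - E * (S * P)"
      by (subst (2) E_def) (rule mult_minus_distrib_mat[OF E _ SP], simp)
    also have "E * (S * P) = 0\<^sub>m s s" using assoc_mult_mat[OF E S P] ES P by simp
    finally have "E * E = E - 0\<^sub>m s s" using E by simp
    also have "\<dots> = E" using E by (intro eq_matI) auto
    finally show ?thesis .
  qed
  \<comment> \<open>If the diagonal of \<open>E\<close> vanished, \<open>S * P\<close> would have
    trace s, whereas its trace equals that of \<open>P * S\<close>, which is n. Characteristic zero
    separates the two.\<close>
  have "\<exists>i < s. \<exists>j < s. E $$ (i, j) \<noteq> 0"
  proof (rule ccontr)
    assume "\<not> ?thesis"
    hence E0: "E $$ (i, i) = 0" if "i < s" for i using that by blast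
    have *: "(S * P) $$ (i, i) = 1" if "i < s" for i
    proof -
      have "E $$ (i, i) = 1 - (S * P) $$ (i, i)"
        unfolding E_def using that carrier_matD[OF SP] by (simp del: index_mult_mat)
      thus ?thesis using E0[OF that] by simp
    qed
    have "of_nat n = (\<Sum>i<n. (P * S) $$ (i, i))" using Suc.prems(3) by simp
    also have "\<dots> = (\<Sum>j < s. (S * P) $$ (j, j))" by (rule sum_diag_mult_commute[OF P S])
    also have "\<dots> = of_nat s" using * by simp
    finally show False using Suc.hyps(2) by simp
  qed
  then obtain i j where ij: "i < s" "j < s" and nz: "E $$ (i, j) \<noteq> 0" by blast
  \<comment> \<open>A row and a rescaled column of \<open>E\<close>: idempotence of \<open>E\<close>
    makes their product 1, and the vanishing of \<open>P * E\<close> and \<open>E * S\<close> makes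
    them orthogonal to what has been built so far.\<close>
  define z where "z = mat 1 s (\<lambda>(_, l). E $$ (i, l))"
  define v where "v = mat s 1 (\<lambda>(l, _). E $$ (l, j) / E $$ (i, j))"
  have z: "z \<in> carrier_mat 1 s" and v: "v \<in> carrier_mat s 1" by (auto simp: z_def v_def)
  have zv: "z * v = 1\<^sub>m 1"
  proof (rule eq_matI)
    fix a b assume "a < dim_row (1\<^sub>m 1 :: 'a mat)" "b < dim_col (1\<^sub>m 1 :: 'a mat)"
    hence ab: "a = 0" "b = 0" by auto
    have "(z * v) $$ (0, 0) = (\<Sum>l < s. E $$ (i, l) * E $$ (l, j)) / E $$ (i, j)"
      by (simp add: z_def v_def scalar_prod_def atLeast0LessThan sum_divide_distrib)
    also have "(\<Sum>l < s. E $$ (i, l) * E $$ (l, j)) = (E * E) $$ (i, j)"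
      using E ij by (simp add: scalar_prod_def atLeast0LessThan)
    finally show "(z * v) $$ (a, b) = 1\<^sub>m 1 $$ (a, b)" using EE nz ab by simp
  qed (simp_all add: z_def v_def)
  have Pv: "P * v = 0\<^sub>m n 1"
  proof (rule eq_matI)
    fix a b assume "a < dim_row (0\<^sub>m n 1 :: 'a mat)" "b < dim_col (0\<^sub>m n 1 :: 'a mat)"
    hence ab: "a < n" "b = 0" by auto
    have "(P * v) $$ (a, 0) = (P * E) $$ (a, j) / E $$ (i, j)"
      using P E ij ab by (simp add: v_def scalar_prod_def atLeast0LessThan sum_divide_distrib)
    thus "(P * v) $$ (a, b) = 0\<^sub>m n 1 $$ (a, b)" using PE ab ij by simp
  qed (use P v in auto)
  have zS: "z * S = 0\<^sub>m 1 n"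
  proof (rule eq_matI)
    fix a b assume "a < dim_row (0\<^sub>m 1 n :: 'a mat)" "b < dim_col (0\<^sub>m 1 n :: 'a mat)"
    hence ab: "a = 0" "b < n" by auto
    have "(z * S) $$ (0, b) = (E * S) $$ (i, b)"
      using S E ij ab by (simp add: z_def scalar_prod_def)
    thus "(z * S) $$ (a, b) = 0\<^sub>m 1 n $$ (a, b)" using ES ab ij by simp
  qed (use S z in auto)
  define P' where "P' = P @\<^sub>r z"
  define S' where "S' = append_cols S v"
  have P': "P' \<in> carrier_mat (n + 1) s" and S': "S' \<in> carrier_mat s (n + 1)"
    unfolding P'_def S'_def
    by (rule carrier_append_rows[OF P z], rule append_cols_carrier[OF S v])
  have "P' * S' = 1\<^sub>m (n + 1)"
    unfolding P'_def S'_def using append_rows_mult_append_cols[OF P z S v] Suc.prems(3) Pv zS zv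
    by simp
  moreover have "m = s - (n + 1)" "n + 1 \<le> s" using Suc.hyps(2) by auto
  ultimately obtain Z Y where Z: "Z \<in> carrier_mat m s" and Y: "Y \<in> carrier_mat s m"
    and 1: "P' * Y = 0\<^sub>m (n + 1) m" "Z * S' = 0\<^sub>m m (n + 1)" "Z * Y = 1\<^sub>m m" "S' * P' + Y * Z = 1\<^sub>m s"
    using Suc.hyps(1)[OF _ P' S'] by metis
  have PY: "P * Y = 0\<^sub>m n m" "z * Y = 0\<^sub>m 1 m"
    using append_rows_inj[of "P * Y" "z * Y" "0\<^sub>m n m" "0\<^sub>m 1 m" n m 1] 1(1) P z Y
    unfolding P'_def append_rows_mult[OF P z Y] zero_append_rows by auto
  have ZS: "Z * S = 0\<^sub>m m n" "Z * v = 0\<^sub>m m 1"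
    using append_cols_inj[of "Z * S" "Z * v" "0\<^sub>m m n" "0\<^sub>m m 1" m n 1] 1(2) S v Z
    unfolding S'_def mult_append_cols[OF S v Z] zero_append_cols by auto
  have m: "s - n = 1 + m" using Suc.hyps(2) by simp
  show ?case unfolding m
  proof (intro exI conjI)
    show "z @\<^sub>r Z \<in> carrier_mat (1 + m) s" "append_cols v Y \<in> carrier_mat s (1 + m)"
      by (rule carrier_append_rows[OF z Z], rule append_cols_carrier[OF v Y])
    show "P * append_cols v Y = 0\<^sub>m n (1 + m)"
      using mult_append_cols[OF v Y P] Pv PY by (simp add: zero_append_cols)
    show "(z @\<^sub>r Z) * S = 0\<^sub>m (1 + m) n"
      using append_rows_mult[OF z Z S] zS ZS by (simp add: zero_append_rows)
    show "(z @\<^sub>r Z) * append_cols v Y = 1\<^sub>m (1 + m)"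
      using append_rows_mult_append_cols[OF z Z v Y] zv PY ZS 1(3) by simp
    have "S * P + append_cols v Y * (z @\<^sub>r Z) = S * P + (v * z + Y * Z)"
      using append_cols_mult_append_rows[OF v Y z Z] by simp
    also have "\<dots> = S * P + v * z + Y * Z"
      using S P v z Y Z by (simp add: assoc_add_mat[of _ s s])
    also have "S * P + v * z = S' * P'"
      unfolding S'_def P'_def using append_cols_mult_append_rows[OF S v P z] by simp
    finally show "S * P + append_cols v Y * (z @\<^sub>r Z) = 1\<^sub>m s" using 1(4) by simp
  qed
qed

section \<open>Intertwining matrices\<close>

lemma intertwine_mult:
  fixes X Y :: "'a :: comm_ring_1 mat"
  assumes A: "A \<in> carrier_mat n n" and B: "B \<in> carrier_mat m m" and C: "C \<in> carrier_mat k k"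
    and X: "X \<in> carrier_mat n m" and Y: "Y \<in> carrier_mat m k" and AX: "A * X = X * B" and BY: "B * Y = Y * C"
  shows "A * (X * Y) = X * Y * C"
proof -
  have "A * (X * Y) = X * (B * Y)"
    by (simp add: assoc_mult_mat[OF A X Y, symmetric] AX assoc_mult_mat[OF X B Y])
  also have "\<dots> = X * Y * C"
    by (simp add: BY assoc_mult_mat[OF X Y C])
  finally show ?thesis .
qed

lemma intertwine_inverse:
  fixes X Y :: "'a :: comm_ring_1 mat"
  assumes A: "A \<in> carrier_mat n n" and B: "B \<in> carrier_mat n n"
    and X: "X \<in> carrier_mat n n" and Y: "Y \<in> carrier_mat n n"
    and AX: "A * X = X * B" and XY: "X * Y = 1\<^sub>m n" and YX: "Y * X = 1\<^sub>m n"
  shows "B * Y = Y * A"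
proof -
  have "B * Y = Y * X * (B * Y)" using B Y by (simp add: YX)
  also have "\<dots> = Y * (X * B * Y)"
    using assoc_mult_mat[OF Y X mult_carrier_mat[OF B Y]] assoc_mult_mat[OF X B Y] by simp
  also have "X * B * Y = A * (X * Y)" by (simp add: AX[symmetric] assoc_mult_mat[OF A X Y])
  also have "\<dots> = A" using A by (simp add: XY)
  finally show ?thesis .
qed

lemma right_inverse_mult:
  fixes X Y :: "'a :: comm_ring_1 mat"
  assumes X: "X \<in> carrier_mat n m" and Y: "Y \<in> carrier_mat m k"
    and X': "X' \<in> carrier_mat m n" and Y': "Y' \<in> carrier_mat k m"
    and XX: "X * X' = 1\<^sub>m n" and YY: "Y * Y' = 1\<^sub>m m"
  shows "(X * Y) * (Y' * X') = 1\<^sub>m n"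
proof -
  have "(X * Y) * (Y' * X') = X * (Y * (Y' * X'))"
    by (rule assoc_mult_mat[OF X Y mult_carrier_mat[OF Y' X']])
  also have "Y * (Y' * X') = X'" using X' by (simp add: assoc_mult_mat[OF Y Y' X', symmetric] YY)
  finally show ?thesis by (simp add: XX)
qed

lemma det_nz_inverse:
  fixes X :: "'a :: field mat"
  assumes "X \<in> carrier_mat n n" "det X \<noteq> 0"
  obtains Y where "Y \<in> carrier_mat n n" "X * Y = 1\<^sub>m n" "Y * X = 1\<^sub>m n"
  using det_non_zero_imp_unit[OF assms, of "()"] by (auto simp: Units_def ring_mat_def)

section \<open>Descent of intertwining matrices from the complex to the real numbers\<close>

lemma map_Re_mult_of_real:
  assumes "A \<in> carrier_mat n m" "X \<in> carrier_mat m k" 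
  shows "map_mat Re (map_mat complex_of_real A * X) = A * map_mat Re X"
    "map_mat Im (map_mat complex_of_real A * X) = A * map_mat Im X"
  using assms by (auto intro!: eq_matI simp: scalar_prod_def)

lemma map_Re_mult_of_real_right:
  assumes "A \<in> carrier_mat n m" "X \<in> carrier_mat k n" 
  shows "map_mat Re (X * map_mat complex_of_real A) = map_mat Re X * A"
    "map_mat Im (X * map_mat complex_of_real A) = map_mat Im X * A"
  using assms by (auto intro!: eq_matI simp: scalar_prod_def)

text \<open>Since \<open>A\<close> and \<open>C\<close> are real, the real and imaginary parts of
  \<open>P\<close> are intertwiners too, and so is P1 + t P2 for every t. The determinant of its
  product with \<open>S\<close> is a polynomial in t with value 1 at the imaginary unit, hence
  non-zero at some real t. Correcting \<open>S\<close> by the inverse of that product and taking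
  real parts gives the partner.\<close>

lemma real_split_intertwiner:
  fixes A C :: "real mat" and P S :: "complex mat"
  defines "A\<^sub>c \<equiv> map_mat complex_of_real A" and "C\<^sub>c \<equiv> map_mat complex_of_real C"
  assumes A: "A \<in> carrier_mat n n" and C: "C \<in> carrier_mat s s"
    and P: "P \<in> carrier_mat n s" and S: "S \<in> carrier_mat s n"
    and AP: "A\<^sub>c * P = P * C\<^sub>c" and CS: "C\<^sub>c * S = S * A\<^sub>c" and PS: "P * S = 1\<^sub>m n"
  obtains P' S' where "P' \<in> carrier_mat n s" "S' \<in> carrier_mat s n"
    "A * P' = P' * C" "C * S' = S' * A" "P' * S' = 1\<^sub>m n"
proof -
  define P1 where "P1 = map_mat Re P"
  define P2 where "P2 = map_mat Im P"
  have P12: "P1 \<in> carrier_mat n s" "P2 \<in> carrier_mat n s" using P by (auto simp: P1_def P2_def)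
  have Ac: "A\<^sub>c \<in> carrier_mat n n" and Cc: "C\<^sub>c \<in> carrier_mat s s"
    using A C by (auto simp: A\<^sub>c_def C\<^sub>c_def)
  have AP1: "A * P1 = P1 * C"
    using arg_cong[OF AP, of "map_mat Re"] A C P unfolding A\<^sub>c_def C\<^sub>c_def P1_def
    by (simp add: map_Re_mult_of_real[of A n n] map_Re_mult_of_real_right[of C s s])
  have AP2: "A * P2 = P2 * C"
    using arg_cong[OF AP, of "map_mat Im"] A C P unfolding A\<^sub>c_def C\<^sub>c_def P2_def
    by (simp add: map_Re_mult_of_real[of A n n] map_Re_mult_of_real_right[of C s s])
  let ?c = "map_mat complex_of_real"
  define N where "N x = (?c P1 + x \<cdot>\<^sub>m ?c P2) * S" for x
  \<comment> \<open>\<open>N x\<close> as a matrix of linear polynomials in x, so that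
    \<open>det M\<close> is its determinant as a polynomial.\<close>
  define M where "M = mat n n (\<lambda>(i, j). [:(?c P1 * S) $$ (i, j), (?c P2 * S) $$ (i, j):])"
  have N: "N x \<in> carrier_mat n n" for x using P12 S by (auto simp: N_def)
  have detN: "poly (det M) x = det (N x)" for x
  proof (rule poly_det_cong[OF N])
    fix i j assume ij: "i < n" "j < n"
    have "N x = ?c P1 * S + x \<cdot>\<^sub>m (?c P2 * S)"
      unfolding N_def using P12 S
      by (simp add: add_mult_distrib_mat[of _ n s] mult_smult_assoc_mat[of _ n s])
    thus "poly (M $$ (i, j)) x = N x $$ (i, j)"
      using ij P12 S by (simp add: M_def)
  qed (simp add: M_def)
  have "?c P1 + \<i> \<cdot>\<^sub>m ?c P2 = P"
    using P by (intro eq_matI) (auto simp: P1_def P2_def complex_eq_iff)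
  hence "N \<i> = 1\<^sub>m n" using PS by (simp add: N_def)
  hence "det M \<noteq> 0" using detN[of \<i>] by auto
  hence "finite {x. poly (det M) x = 0}" by (rule poly_roots_finite)
  moreover have "infinite (range complex_of_real)"
    using finite_imageD[of complex_of_real UNIV] infinite_UNIV_char_0[where 'a = real] by (auto simp: inj_of_real)
  ultimately have "\<not> range complex_of_real \<subseteq> {x. poly (det M) x = 0}"
    using finite_subset by blast
  then obtain t where t: "det (N (complex_of_real t)) \<noteq> 0" using detN by auto
  define P' where "P' = P1 + t \<cdot>\<^sub>m P2"
  have P': "P' \<in> carrier_mat n s" using P12 by (simp add: P'_def)
  have AP': "A * P' = P' * C"
    unfolding P'_def using A C P12 AP1 AP2
    by (simp add: mult_add_distrib_mat[of A n n _ s] add_mult_distrib_mat[of _ n s _ C s]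
        mult_smult_distrib[of A n n _ s] mult_smult_assoc_mat[of _ n s C s])
  have cP': "?c P' = ?c P1 + complex_of_real t \<cdot>\<^sub>m ?c P2"
    using P12 by (intro eq_matI) (auto simp: P'_def)
  have cP'c: "?c P' \<in> carrier_mat n s" using P' by simp
  have AcP': "A\<^sub>c * ?c P' = ?c P' * C\<^sub>c"
    unfolding A\<^sub>c_def C\<^sub>c_def using arg_cong[OF AP', of ?c] A C P'
    by (simp add: of_real_hom.mat_hom_mult[of A n n] of_real_hom.mat_hom_mult[of P' n s])
  define G where "G = ?c P' * S"
  have G: "G \<in> carrier_mat n n" "det G \<noteq> 0"
    using t mult_carrier_mat[OF cP'c S] cP' by (auto simp: G_def N_def)
  obtain H where H: "H \<in> carrier_mat n n" "G * H = 1\<^sub>m n" "H * G = 1\<^sub>m n"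
    using det_nz_inverse[OF G] .
  \<comment> \<open>\<open>G\<close> commutes with \<open>A\<close>, and so does its inverse
    \<open>H\<close>; therefore \<open>S * H\<close> is still an intertwiner.\<close>
  have AG: "A\<^sub>c * G = G * A\<^sub>c"
    unfolding G_def by (rule intertwine_mult[OF Ac Cc Ac cP'c S AcP' CS])
  have AH: "A\<^sub>c * H = H * A\<^sub>c" by (rule intertwine_inverse[OF Ac Ac G(1) H(1) AG H(2,3)])
  \<comment> \<open>Taking real parts preserves both required equations because \<open>P'\<close>,
    \<open>A\<close> and \<open>C\<close> are real.\<close>
  define S' where "S' = map_mat Re (S * H)"
  have SH: "S * H \<in> carrier_mat s n" using S H by simp
  have "C\<^sub>c * (S * H) = S * H * A\<^sub>c"
    by (rule intertwine_mult[OF Cc Ac Ac S H(1) CS AH])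
  hence CS': "C * S' = S' * A"
    unfolding S'_def C\<^sub>c_def A\<^sub>c_def
    by (metis map_Re_mult_of_real(1)[OF C SH] map_Re_mult_of_real_right(1)[OF A SH])
  have "?c P' * (S * H) = 1\<^sub>m n"
    using assoc_mult_mat[OF cP'c S H(1)] H(2) by (simp add: G_def)
  hence "map_mat Re (1\<^sub>m n) = P' * S'"
    unfolding S'_def using map_Re_mult_of_real(1)[OF P' SH] by simp
  moreover have "map_mat Re (1\<^sub>m n) = 1\<^sub>m n" by (intro eq_matI) auto
  ultimately have "P' * S' = 1\<^sub>m n" by simp
  moreover have "S' \<in> carrier_mat s n" using SH by (simp add: S'_def)
  ultimately show ?thesis using that P' AP' CS' by blast
qed

section \<open>Diagonalization, and placing the eigenvalues in the copies of the companion
  matrix\<close>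

lemma order_prod_linear:
  "order z (\<Prod>a\<leftarrow>xs. [:- a, 1:]) = count_list xs (z :: 'a :: idom)"
proof -
  have ord: "order z (pCons (- a) 1) = of_bool (a = z)" for a
    by (simp only: one_pCons order_linear') auto
  have "order z (\<Prod>a\<leftarrow>xs. [:- a, 1:]) = sum_list (map (order z) (map (\<lambda>a. [:- a, 1:]) xs))"
    by (rule order_prod_list) auto
  also have "\<dots> = count_list xs z" by (induction xs) (auto simp: ord)
  finally show ?thesis .
qed

lemma count_list_map_upt: "count_list (map g [0..<n]) z = card {k. k < n \<and> g k = z}"
proof (induction n)
  case (Suc n)
  have "{k. k < Suc n \<and> g k = z} = (if g n = z then insert n {k. k < n \<and> g k = z} else {k. k < n \<and> g k = z})"
    by (auto simp: less_Suc_eq)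
  thus ?case using Suc by simp
qed simp

lemma diagonalizable_C_obtain:
  assumes "diagonalizable_C T" "T \<in> carrier_mat n n"
  obtains \<delta> V W where "V \<in> carrier_mat n n" "W \<in> carrier_mat n n" "V * W = 1\<^sub>m n" "W * V = 1\<^sub>m n"
    "T * V = V * mat_diag n \<delta>" "\<And>z. alg_mult T z = card {k. k < n \<and> \<delta> k = z}"
    "\<And>k. k < n \<Longrightarrow> \<delta> k \<in> eigenvalues_C T"
proof -
  obtain D V W where D: "diagonal_mat D" and w: "similar_mat_wit T D V W"
    using assms(1) by (auto simp: diagonalizable_C_def similar_mat_def)
  note wit = similar_mat_witD2[OF assms(2) w]
  define \<delta> where "\<delta> k = D $$ (k, k)" for k
  have Dd: "D = mat_diag n \<delta>"
    using D wit by (intro eq_matI) (auto simp: mat_diag_def \<delta>_def diagonal_mat_def)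
  have "T * V = V * D * W * V" using wit by simp
  also have "\<dots> = V * D * (W * V)" using wit by (simp add: assoc_mult_mat[of _ n n _ n _ n])
  also have "\<dots> = V * D" using wit by simp
  finally have TV: "T * V = V * mat_diag n \<delta>" by (simp add: Dd)
  have "char_poly T = char_poly D"
    using w by (intro char_poly_similar) (auto simp: similar_mat_def)
  also have "\<dots> = (\<Prod>a\<leftarrow>diag_mat D. [:- a, 1:])"
    using D wit by (intro char_poly_upper_triangular[of _ n]) (auto simp: diagonal_mat_def)
  also have "diag_mat D = map \<delta> [0..<n]" using wit by (auto simp: diag_mat_def \<delta>_def)
  finally have cp: "char_poly T = (\<Prod>a\<leftarrow>map \<delta> [0..<n]. [:- a, 1:])" .
  have "alg_mult T z = card {k. k < n \<and> \<delta> k = z}" for z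
    unfolding alg_mult_def cp order_prod_linear by (rule count_list_map_upt)
  moreover have "\<delta> k \<in> eigenvalues_C T" if "k < n" for k
  proof -
    have "poly (\<Prod>a\<leftarrow>map \<delta> [0..<n]. [:- a, 1:]) (\<delta> k) = 0"
      using that by (auto simp: poly_prod_list prod_list_zero_iff)
    thus ?thesis by (simp add: eigenvalues_C_def cp)
  qed
  ultimately show ?thesis using that wit TV by blast
qed

lemma kron_one_mat_diag: "kron (1\<^sub>m N) (mat_diag d w) = mat_diag (N * d) (\<lambda>b. w (b mod d))"
proof (rule eq_matI)
  fix i j assume "i < dim_row (mat_diag (N * d) (\<lambda>b. w (b mod d)))" "j < dim_col (mat_diag (N * d) (\<lambda>b. w (b mod d)))"
  hence ij: "i < N * d" "j < N * d" by (auto simp: mat_diag_def)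
  have "i = j \<longleftrightarrow> i div d = j div d \<and> i mod d = j mod d"
    by (metis div_mult_mod_eq)
  thus "kron (1\<^sub>m N) (mat_diag d w) $$ (i, j) = mat_diag (N * d) (\<lambda>b. w (b mod d)) $$ (i, j)"
    using ij less_mult_imp_div_less[OF ij(1)] less_mult_imp_div_less[OF ij(2)]
      mod_less_mult[OF ij(1)] mod_less_mult[OF ij(2)]
    by (subst index_kron[of _ N N _ d d]) (auto simp: mat_diag_def)
qed (auto simp: mat_diag_def)

text \<open>Picks the coordinates \<open>\<kappa> k\<close> for \<open>k < n\<close>; the transpose
  embeds them back and is a right inverse if \<open>\<kappa>\<close> is injective into the
  \<open>s\<close> coordinates.\<close>

definition select_mat :: "nat \<Rightarrow> nat \<Rightarrow> (nat \<Rightarrow> nat) \<Rightarrow> 'a :: comm_ring_1 mat" where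
  "select_mat n s \<kappa> = mat n s (\<lambda>(k, b). of_bool (b = \<kappa> k))"

lemma select_mat_carrier [simp]: "select_mat n s \<kappa> \<in> carrier_mat n s"
  by (simp add: select_mat_def)

lemma select_mat_transpose:
  assumes "inj_on \<kappa> {..<n}" "\<And>k. k < n \<Longrightarrow> \<kappa> k < s"
  shows "select_mat n s \<kappa> * transpose_mat (select_mat n s \<kappa>) = (1\<^sub>m n :: 'a :: comm_ring_1 mat)"
proof (rule eq_matI)
  fix k l assume "k < dim_row (1\<^sub>m n :: 'a mat)" "l < dim_col (1\<^sub>m n :: 'a mat)"
  hence kl: "k < n" "l < n" by auto
  have "(select_mat n s \<kappa> * transpose_mat (select_mat n s \<kappa>)) $$ (k, l) =
      (\<Sum>b < s. of_bool (b = \<kappa> k) * of_bool (b = \<kappa> l) :: 'a)"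
    using kl by (simp add: select_mat_def scalar_prod_def atLeast0LessThan)
  also have "\<dots> = (\<Sum>b < s. if b = \<kappa> k then of_bool (\<kappa> k = \<kappa> l) else 0)"
    by (intro sum.cong) auto
  also have "\<dots> = of_bool (k = l)"
    using assms kl by (auto simp: inj_on_def)
  finally show "(select_mat n s \<kappa> * transpose_mat (select_mat n s \<kappa>)) $$ (k, l) = (1\<^sub>m n :: 'a mat) $$ (k, l)"
    using kl by simp
qed (simp_all add: select_mat_def)

lemma select_mat_diag:
  assumes "\<And>k. k < n \<Longrightarrow> w (\<kappa> k) = \<delta> k"
  shows "mat_diag n \<delta> * select_mat n s \<kappa> = select_mat n s \<kappa> * mat_diag s w"
    "mat_diag s w * transpose_mat (select_mat n s \<kappa>) = transpose_mat (select_mat n s \<kappa>) * mat_diag n \<delta>"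
proof -
  let ?Q = "select_mat n s \<kappa> :: 'a mat"
  have Q: "?Q \<in> carrier_mat n s" "transpose_mat ?Q \<in> carrier_mat s n" by simp_all
  show "mat_diag n \<delta> * ?Q = ?Q * mat_diag s w"
    unfolding mat_diag_mult_left[OF Q(1)] mat_diag_mult_right[OF Q(1)] using assms
    by (intro eq_matI) (auto simp: select_mat_def)
  show "mat_diag s w * transpose_mat ?Q = transpose_mat ?Q * mat_diag n \<delta>"
    unfolding mat_diag_mult_left[OF Q(2)] mat_diag_mult_right[OF Q(2)] using assms
    by (intro eq_matI) (auto simp: select_mat_def)
qed

context min_poly_Q
begin

text \<open>Over the complex numbers \<open>C\<close> is diagonalizable, with every root of
  \<open>f\<close> in \<open>N\<close> slots, one per copy. The bound on the multiplicities allows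
  an injection of the eigenvalues of \<open>T\<close> into slots of equal value; \<open>P\<close>
  and \<open>S\<close> are the resulting selection and embedding, composed with the two changes of
  basis.\<close>

lemma complex_intertwiner:
  fixes T :: "complex mat" and N :: nat
  defines "C \<equiv> kron (1\<^sub>m N) (companion (map_poly of_rat f))"
  assumes T: "T \<in> carrier_mat n n" "diagonalizable_C T"
    and ev: "eigenvalues_C T \<subseteq> roots_C f" and N: "\<And>z. alg_mult T z \<le> N"
  obtains P S where "P \<in> carrier_mat n (N * degree f)" "S \<in> carrier_mat (N * degree f) n"
    "T * P = P * C" "C * S = S * T" "P * S = 1\<^sub>m n"
proof -
  let ?d = "degree f"
  let ?s = "N * ?d"
  let ?Cf = "companion (map_poly of_rat f :: complex poly)"
  obtain \<delta> V W where V: "V \<in> carrier_mat n n" and W: "W \<in> carrier_mat n n"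
    and VW: "V * W = 1\<^sub>m n" "W * V = 1\<^sub>m n" and TV: "T * V = V * mat_diag n \<delta>"
    and mult: "\<And>z. alg_mult T z = card {k. k < n \<and> \<delta> k = z}"
    and \<delta>: "\<And>k. k < n \<Longrightarrow> \<delta> k \<in> eigenvalues_C T"
    by (rule diagonalizable_C_obtain[OF T(2,1)]) blast
  \<comment> \<open>\<open>\<rho> k\<close> counts the earlier occurrences of the eigenvalue
    \<open>\<delta> k\<close> and serves as the number of the copy that receives it;
    \<open>\<iota>\<close> gives the position of a root inside a copy, and \<open>\<kappa> k\<close>
    is the slot.\<close>
  define \<rho> where "\<rho> k = card {l. l < k \<and> \<delta> l = \<delta> k}" for k
  define \<iota> where "\<iota> z = inv_into {..<?d} rt z" for z
  define \<kappa> where "\<kappa> k = \<rho> k * ?d + \<iota> (\<delta> k)" for k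
  have \<iota>: "\<iota> (\<delta> k) < ?d" "rt (\<iota> (\<delta> k)) = \<delta> k" if "k < n" for k
  proof -
    have "\<delta> k \<in> rt ` {..<?d}" using \<delta>[OF that] ev bij_betw_imp_surj_on[OF bij_rt] by blast
    thus "\<iota> (\<delta> k) < ?d" "rt (\<iota> (\<delta> k)) = \<delta> k"
      unfolding \<iota>_def using inv_into_into lessThan_iff f_inv_into_f by metis+
  qed
  have \<rho>: "\<rho> k < N" if "k < n" for k
  proof -
    have "\<rho> k < card {l. l < n \<and> \<delta> l = \<delta> k}"
      unfolding \<rho>_def using that by (intro psubset_card_mono) auto
    thus ?thesis using N[of "\<delta> k"] mult by simp
  qed
  have \<rho>_less: "\<rho> k < \<rho> l" if "k < l" "\<delta> k = \<delta> l" for k l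
    unfolding \<rho>_def using that by (intro psubset_card_mono) auto
  have div_mod: "\<kappa> k div ?d = \<rho> k" "\<kappa> k mod ?d = \<iota> (\<delta> k)" if "k < n" for k
    using \<iota>[OF that] by (auto simp: \<kappa>_def)
  have inj: "inj_on \<kappa> {..<n}"
  proof (rule inj_onI)
    fix k l assume kl: "k \<in> {..<n}" "l \<in> {..<n}" "\<kappa> k = \<kappa> l"
    have "\<rho> k = \<rho> l" using kl div_mod(1)[of k] div_mod(1)[of l] by simp
    moreover have "\<delta> k = \<delta> l" using kl div_mod(2)[of k] div_mod(2)[of l] \<iota>(2)[of k] \<iota>(2)[of l] by simp
    ultimately show "k = l" using \<rho>_less[of k l] \<rho>_less[of l k] by (cases k l rule: linorder_cases) auto
  qed
  have lt: "\<kappa> k < ?s" if "k < n" for k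
  proof -
    have "\<kappa> k < (\<rho> k + 1) * ?d" using \<iota>[OF that] by (simp add: \<kappa>_def)
    also have "\<dots> \<le> N * ?d" using \<rho>[OF that] by (intro mult_right_mono) auto
    finally show ?thesis .
  qed
  define Q :: "complex mat" where "Q = select_mat n ?s \<kappa>"
  have Q: "Q \<in> carrier_mat n ?s" and QT: "transpose_mat Q \<in> carrier_mat ?s n"
    and QQ: "Q * transpose_mat Q = 1\<^sub>m n"
    using select_mat_transpose[OF inj lt] by (simp_all add: Q_def)
  let ?D = "kron (1\<^sub>m N) (mat_diag ?d rt)"
  have D: "?D \<in> carrier_mat ?s ?s" by simp
  have \<Delta>: "mat_diag n \<delta> \<in> carrier_mat n n" by simp
  have \<Delta>Q: "mat_diag n \<delta> * Q = Q * ?D" "?D * transpose_mat Q = transpose_mat Q * mat_diag n \<delta>"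
    unfolding kron_one_mat_diag Q_def by (intro select_mat_diag; simp add: div_mod \<iota>)+
  let ?V = "vandermonde ?d rt"
  have Vc: "?V \<in> carrier_mat ?d ?d" by simp
  obtain U where U: "U \<in> carrier_mat ?d ?d" "?V * U = 1\<^sub>m ?d" "U * ?V = 1\<^sub>m ?d"
    using det_nz_inverse[OF Vc det_vandermonde_rt] .
  have Cf: "?Cf \<in> carrier_mat ?d ?d" using companion_carrier[of "map_poly of_rat f :: complex poly"] by simp
  have C: "C \<in> carrier_mat ?s ?s" unfolding C_def using Cf by simp
  define K where "K = kron (1\<^sub>m N) ?V"
  define K' where "K' = kron (1\<^sub>m N) U"
  have K: "K \<in> carrier_mat ?s ?s" "K' \<in> carrier_mat ?s ?s" using U by (auto simp: K_def K'_def)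
  have KK': "K * K' = 1\<^sub>m ?s" "K' * K = 1\<^sub>m ?s"
    unfolding K_def K'_def using U
    by (simp_all add: kron_mult[of _ N N _ ?d ?d _ N _ ?d] kron_one)
  have DK: "?D * K = K * C"
    unfolding K_def C_def using Cf
    by (simp add: kron_mult[of _ N N _ ?d ?d _ N _ ?d] vandermonde_rt)
  have CK': "C * K' = K' * ?D" by (rule intertwine_inverse[OF D C K DK KK'])
  have WT: "mat_diag n \<delta> * W = W * T" by (rule intertwine_inverse[OF T(1) \<Delta> V W TV VW])
  define P where "P = V * Q * K"
  define S where "S = K' * transpose_mat Q * W"
  have VQ: "V * Q \<in> carrier_mat n ?s" and KQ: "K' * transpose_mat Q \<in> carrier_mat ?s n"
    using V Q K QT by auto
  show ?thesis
  proof
    show "P \<in> carrier_mat n ?s" "S \<in> carrier_mat ?s n"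
      using VQ K KQ W by (auto simp: P_def S_def)
    show "T * P = P * C" unfolding P_def
      by (rule intertwine_mult[OF T(1) D C VQ K(1) _ DK])
        (rule intertwine_mult[OF T(1) \<Delta> D V Q TV \<Delta>Q(1)])
    show "C * S = S * T" unfolding S_def
      by (rule intertwine_mult[OF C \<Delta> T(1) KQ W _ WT])
        (rule intertwine_mult[OF C D \<Delta> K(2) QT CK' \<Delta>Q(2)])
    have "V * Q * (transpose_mat Q * W) = 1\<^sub>m n"
      by (rule right_inverse_mult[OF V Q W QT VW(1) QQ])
    hence "(V * Q) * K * (K' * (transpose_mat Q * W)) = 1\<^sub>m n"
      by (rule right_inverse_mult[OF VQ K(1) mult_carrier_mat[OF QT W] K(2) _ KK'(1)])
    thus "P * S = 1\<^sub>m n"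
      unfolding P_def S_def using assoc_mult_mat[OF K(2) QT W] by simp
  qed
qed

lemma real_intertwiner:
  fixes A :: "real mat" and N :: nat
  defines "C \<equiv> kron (1\<^sub>m N) (companion (map_poly of_rat f))"
    and "T \<equiv> map_mat complex_of_real A"
  assumes A: "A \<in> carrier_mat n n" "diagonalizable_C T"
    and ev: "eigenvalues_C T \<subseteq> roots_C f" and N: "\<And>z. alg_mult T z \<le> N"
  obtains P S where "P \<in> carrier_mat n (N * degree f)" "S \<in> carrier_mat (N * degree f) n"
    "A * P = P * C" "C * S = S * A" "P * S = 1\<^sub>m n"
proof -
  let ?s = "N * degree f"
  have Cf: "companion (map_poly of_rat f :: real poly) \<in> carrier_mat (degree f) (degree f)"
    using companion_carrier[of "map_poly of_rat f :: real poly"] by simp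
  have C: "C \<in> carrier_mat ?s ?s" unfolding C_def using Cf by simp
  have T: "T \<in> carrier_mat n n" using A by (simp add: T_def)
  have eq: "kron (1\<^sub>m N) (companion (map_poly of_rat f)) = map_mat complex_of_real C"
    unfolding C_def using Cf
    by (simp add: of_real_hom.kron_hom[OF one_carrier_mat] of_real_hom.companion_hom of_real_hom.mat_hom_one map_poly_complex_of_rat)
  obtain P S where "P \<in> carrier_mat n ?s" "S \<in> carrier_mat ?s n"
    "T * P = P * map_mat complex_of_real C" "map_mat complex_of_real C * S = S * T" "P * S = 1\<^sub>m n"
    using complex_intertwiner[OF T A(2) ev N] unfolding eq by metis
  from real_split_intertwiner[OF A(1) C this(1,2) this(3,4,5)[unfolded T_def]] that
  show ?thesis by blast
qed

end

section \<open>Generic twists\<close>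

definition int_vecs :: "nat \<Rightarrow> real vec set" where
  "int_vecs m = {r \<in> carrier_vec m. \<forall>i<m. r $ i \<in> \<int>}"

lemma countable_int_vecs: "countable (int_vecs m)"
proof (rule countable_subset)
  show "int_vecs m \<subseteq> range (\<lambda>xs. vec_of_list (map real_of_int xs))"
  proof
    fix r assume r: "r \<in> int_vecs m"
    have "r = vec_of_list (map real_of_int (map (\<lambda>i. \<lfloor>r $ i\<rfloor>) [0..<m]))"
      using r by (intro eq_vecI) (auto simp: int_vecs_def vec_of_list_index simp del: vec_of_list_map)
    thus "r \<in> range (\<lambda>xs. vec_of_list (map real_of_int xs))" by blast
  qed
qed simp

lemma int_vecs_of_rat:
  assumes "r \<in> int_vecs m"
  obtains r' :: "rat vec" where "r' \<in> carrier_vec m" "r = map_vec of_rat r'"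
proof
  show "r = map_vec of_rat (vec m (\<lambda>i. of_int \<lfloor>r $ i\<rfloor>))"
    using assms by (intro eq_vecI) (auto simp: int_vecs_def)
qed simp

text \<open>Each polynomial has finitely many roots, so countably many of them cannot exhaust an
  interval. Positive t are chosen because the inverse of the twist needs a non-zero
  denominator.\<close>

lemma exists_generic_parameter:
  fixes Q :: "'b \<Rightarrow> real \<Rightarrow> bool"
  assumes "countable I"
    and "\<And>i. i \<in> I \<Longrightarrow> \<exists>p. p \<noteq> 0 \<and> (\<forall>t>0. poly p t \<noteq> 0 \<longrightarrow> Q i t)"
  shows "\<exists>t>0. \<forall>i\<in>I. Q i t"
proof -
  obtain P where P: "\<And>i. i \<in> I \<Longrightarrow> P i \<noteq> 0" "\<And>i t. i \<in> I \<Longrightarrow> t > 0 \<Longrightarrow> poly (P i) t \<noteq> 0 \<Longrightarrow> Q i t"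
    using assms(2) by metis
  have "countable (\<Union>i\<in>I. {x. poly (P i) x = 0})"
    using P(1) by (intro countable_UN assms(1) countable_finite poly_roots_finite)
  moreover have "uncountable {0<..<1::real}" by (simp add: uncountable_open_interval)
  ultimately have "\<not> {0<..<1} \<subseteq> (\<Union>i\<in>I. {x. poly (P i) x = 0})"
    using countable_subset by blast
  then obtain t where "t \<in> {0<..<1}" "\<forall>i\<in>I. poly (P i) t \<noteq> 0" by blast
  thus ?thesis using P(2) by auto
qed

text \<open>The exponents are \<open>1 + m\<close> with \<open>m = i + N * j\<close>, the expansion
  of \<open>m\<close> to base \<open>N\<close>. They are distinct and positive, so no coefficients
  merge, and \<open>a\<close> remains the constant one.\<close>

lemma grid_poly:
  fixes a :: real
  assumes "a \<noteq> 0 \<or> (\<exists>i<N. \<exists>j<N. e i j \<noteq> 0)"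
  shows "\<exists>p. p \<noteq> 0 \<and> (\<forall>t. poly p t = a + (\<Sum>i<N. \<Sum>j<N. e i j * t ^ (1 + i + N * j)))"
proof -
  define q where "q = (\<Sum>m<N * N. monom (e (m mod N) (m div N)) m)"
  have coeff: "poly.coeff q m = (if m < N * N then e (m mod N) (m div N) else 0)" for m
    by (simp add: q_def coeff_sum sum.delta)
  have "pCons a q \<noteq> 0"
  proof (cases "a = 0")
    case True
    then obtain i j where ij: "i < N" "j < N" "e i j \<noteq> 0" using assms by blast
    have "i + N * j < N * Suc j" using ij by simp
    also have "\<dots> \<le> N * N" using ij by (intro mult_left_mono) auto
    finally have "poly.coeff q (i + N * j) = e i j" using ij by (simp add: coeff)
    thus ?thesis using ij(3) by auto
  qed simp
  moreover have "poly (pCons a q) t = a + (\<Sum>i<N. \<Sum>j<N. e i j * t ^ (1 + i + N * j))" for t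
  proof -
    have "poly q t = (\<Sum>m<N * N. e (m mod N) (m div N) * t ^ (m div N * N + m mod N))"
      by (simp add: q_def poly_sum Polynomial.poly_monom)
    also have "\<dots> = (\<Sum>j<N. \<Sum>i<N. e i j * t ^ (j * N + i))"
      by (rule sum_div_mod)
    finally show ?thesis
      by (subst sum.swap) (simp add: sum_distrib_left power_add mult_ac)
  qed
  ultimately show ?thesis by blast
qed

definition block_vec :: "nat \<Rightarrow> 'a vec \<Rightarrow> nat \<Rightarrow> 'a vec" where
  "block_vec d r j = vec d (\<lambda>l. r $ (j * d + l))"

lemma block_vec_carrier [simp]: "block_vec d r j \<in> carrier_vec d"
  by (simp add: block_vec_def)

lemma block_index_less: "j < N \<Longrightarrow> l < d \<Longrightarrow> j * d + l < N * (d :: nat)"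
proof -
  assume "j < N" "l < d"
  hence "j * d + l < Suc j * d" by simp
  also have "\<dots> \<le> N * d" using \<open>j < N\<close> by (intro mult_right_mono) auto
  finally show ?thesis .
qed

lemma block_vec_int: "r \<in> int_vecs (N * d) \<Longrightarrow> j < N \<Longrightarrow> block_vec d r j \<in> int_vecs d"
  by (simp add: int_vecs_def block_vec_def block_index_less)

lemma block_vec_nz:
  assumes "r \<in> carrier_vec (N * d)" "r \<noteq> 0\<^sub>v (N * d)"
  obtains j where "j < N" "block_vec d r j \<noteq> 0\<^sub>v d"
proof -
  obtain b where b: "b < N * d" "r $ b \<noteq> 0"
    using assms by (metis carrier_vecD eq_vecI index_zero_vec)
  have "block_vec d r (b div d) $ (b mod d) \<noteq> 0" "b mod d < d"
    using b mod_less_mult[OF b(1)] by (auto simp: block_vec_def)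
  hence "block_vec d r (b div d) \<noteq> 0\<^sub>v d" by auto
  thus ?thesis using that less_mult_imp_div_less[OF b(1)] by blast
qed

text \<open>The inclusion of block \<open>i\<close>: multiplication by it on the right extracts a
  block of columns, and its transpose extracts a block of a vector.\<close>

definition block_col :: "nat \<Rightarrow> nat \<Rightarrow> nat \<Rightarrow> 'a :: comm_ring_1 mat" where
  "block_col N d i = kron (mat N 1 (\<lambda>(a, _). of_bool (a = i))) (1\<^sub>m d)"

lemma block_col_carrier [simp]: "block_col N d i \<in> carrier_mat (N * d) d"
proof -
  have "block_col N d i \<in> carrier_mat (N * d) (1 * d)"
    unfolding block_col_def by (intro kron_carrier) auto
  thus ?thesis by simp
qed

lemma dim_block_col [simp]: "dim_row (block_col N d i) = N * d" "dim_col (block_col N d i) = d"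
  by (simp_all add: block_col_def)

lemma col_block_col:
  assumes "l < d" "i < N"
  shows "col (block_col N d i) l = unit_vec (N * d) (i * d + l)"
proof (rule eq_vecI)
  fix b assume "b < dim_vec (unit_vec (N * d) (i * d + l) :: 'a vec)"
  hence b: "b < N * d" by simp
  have "b = i * d + l \<longleftrightarrow> b div d = i \<and> b mod d = l"
    using assms by (metis div_mult_mod_eq div_mult_self3 div_less add.right_neutral mod_mult_self3 mod_less add_cancel_right_right
        gr_implies_not0 less_nat_zero_code)
  thus "col (block_col N d i) l $ b = (unit_vec (N * d) (i * d + l) :: 'a vec) $ b"
    using b assms less_mult_imp_div_less[OF b] mod_less_mult[OF b]
    by (auto simp: block_col_def kron_def block_index_less)
qed (simp add: block_col_def)

lemma block_col_transpose_mult_vec: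
  assumes "r \<in> carrier_vec (N * d)" "i < N"
  shows "transpose_mat (block_col N d i) *\<^sub>v r = block_vec d r i"
proof (rule eq_vecI)
  fix l assume "l < dim_vec (block_vec d r i)"
  hence l: "l < d" by (simp add: block_vec_def)
  have "(transpose_mat (block_col N d i) *\<^sub>v r) $ l = col (block_col N d i) l \<bullet> r"
    using l carrier_matD[OF block_col_carrier[of N d i, where 'a = 'a]] by simp
  also have "\<dots> = r $ (i * d + l)"
    using assms l block_index_less[of i N l d] by (simp add: col_block_col scalar_prod_left_unit)
  finally show "(transpose_mat (block_col N d i) *\<^sub>v r) $ l = block_vec d r i $ l"
    using l by (simp add: block_vec_def)
qed (use carrier_matD[OF block_col_carrier[of N d i, where 'a = 'a]] in \<open>simp add: block_vec_def\<close>)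

lemma mult_block_col:
  assumes "R \<in> carrier_mat k (N * d)" "a < k" "l < d" "i < N"
  shows "(R * block_col N d i) $$ (a, l) = R $$ (a, i * d + l)"
proof -
  have "(R * block_col N d i) $$ (a, l) = row R a \<bullet> col (block_col N d i) l"
    using assms carrier_matD[OF block_col_carrier[of N d i, where 'a = 'a]] by simp
  also have "\<dots> = R $$ (a, i * d + l)"
    using assms block_index_less[of i N l d] by (simp add: col_block_col scalar_prod_right_unit)
  finally show ?thesis .
qed

lemma mult_block_col_nz:
  assumes "R \<in> carrier_mat k (N * d)" "R \<noteq> 0\<^sub>m k (N * d)"
  obtains i where "i < N" "R * block_col N d i \<noteq> 0\<^sub>m k d"
proof -
  obtain a b where ab: "a < k" "b < N * d" "R $$ (a, b) \<noteq> 0"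
    using assms by (metis carrier_matD eq_matI index_zero_mat)
  have "(R * block_col N d (b div d)) $$ (a, b mod d) = R $$ (a, b)"
    using mult_block_col[OF assms(1) ab(1) mod_less_mult[OF ab(2)] less_mult_imp_div_less[OF ab(2)]] by simp
  hence "R * block_col N d (b div d) \<noteq> 0\<^sub>m k d" using ab mod_less_mult[OF ab(2)] by auto
  thus ?thesis using that less_mult_imp_div_less[OF ab(2)] by blast
qed

text \<open>Each copy is invariant, so every column block of an intertwiner for the \<open>N\<close>
  copies is an intertwiner for a single one.\<close>

lemma block_col_intertwine:
  assumes M: "M \<in> carrier_mat d d"
  shows "kron (1\<^sub>m N) M * block_col N d i = block_col N d i * M"
proof -
  let ?e = "mat N 1 (\<lambda>(a, _). of_bool (a = i)) :: 'a mat"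
  have e: "?e \<in> carrier_mat N 1" by simp
  have "block_col N d i * M = kron ?e (1\<^sub>m d) * kron (1\<^sub>m 1) M"
    using kron_one_left[OF M] by (simp add: block_col_def)
  thus ?thesis unfolding block_col_def
    using M kron_mult[OF one_carrier_mat M e one_carrier_mat] kron_mult[OF e one_carrier_mat one_carrier_mat M] e
    by simp
qed

text \<open>The rank-one product of the column with entries t^(1+i) and the row with entries t^(Nj).
  The exponents run through 1, ..., N^2 without repetition.\<close>

definition twist_mat :: "nat \<Rightarrow> real \<Rightarrow> real mat" where
  "twist_mat N t = mat N N (\<lambda>(i, j). t ^ (1 + i + N * j))"

lemma twist_mat_carrier [simp]: "twist_mat N t \<in> carrier_mat N N"
  by (simp add: twist_mat_def)

lemma dim_twist_mat [simp]: "dim_row (twist_mat N t) = N" "dim_col (twist_mat N t) = N"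
  by (simp_all add: twist_mat_def)

text \<open>Rank one: the square is the trace times the matrix.\<close>

lemma twist_mat_square:
  "twist_mat N t * twist_mat N t = (\<Sum>i<N. t ^ (1 + i + N * i)) \<cdot>\<^sub>m twist_mat N t"
  by (rule eq_matI)
    (auto simp: twist_mat_def scalar_prod_def atLeast0LessThan sum_distrib_left power_add mult_ac
      intro!: sum.cong)

text \<open>Each pair of blocks receives its own power of t; this is the form to which
  \<open>grid_poly\<close> applies.\<close>

lemma scalar_prod_kron_twist:
  assumes w: "w \<in> carrier_vec (N * d)" and r: "r \<in> carrier_vec (N * d)"
  shows "w \<bullet> (kron (twist_mat N t) (1\<^sub>m d) *\<^sub>v r) =
    (\<Sum>i<N. \<Sum>j<N. (block_vec d w i \<bullet> block_vec d r j) * t ^ (1 + i + N * j))"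
proof -
  let ?K = "kron (twist_mat N t) (1\<^sub>m d)"
  have K: "?K \<in> carrier_mat (N * d) (N * d)" by simp
  have Kr: "(?K *\<^sub>v r) $ b = (\<Sum>j<N. t ^ (1 + b div d + N * j) * r $ (j * d + b mod d))"
    if b: "b < N * d" for b
  proof -
    have "(?K *\<^sub>v r) $ b = (\<Sum>c<N * d. ?K $$ (b, c) * r $ c)"
      using K b r by (simp add: scalar_prod_def atLeast0LessThan)
    also have "\<dots> = (\<Sum>c<N * d. t ^ (1 + b div d + N * (c div d)) * of_bool (c mod d = b mod d) * 
        r $ (c div d * d + c mod d))"
      using b less_mult_imp_div_less mod_less_mult
      by (intro sum.cong refl) (auto simp: index_kron[of _ N N _ d d] twist_mat_def)
    also have "\<dots> = (\<Sum>j<N. \<Sum>l<d. t ^ (1 + b div d + N * j) * of_bool (l = b mod d) * r $ (j * d + l))"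
      by (rule sum_div_mod)
    also have "\<dots> = (\<Sum>j<N. \<Sum>l<d. if l = b mod d then t ^ (1 + b div d + N * j) * r $ (j * d + b mod d) else 0)"
      by (intro sum.cong) auto
    also have "\<dots> = (\<Sum>j<N. t ^ (1 + b div d + N * j) * r $ (j * d + b mod d))"
      using mod_less_mult[OF b] by simp
    finally show ?thesis .
  qed
  have "w \<bullet> (?K *\<^sub>v r) = (\<Sum>b<N * d. w $ (b div d * d + b mod d) *
      (\<Sum>j<N. t ^ (1 + b div d + N * j) * r $ (j * d + b mod d)))"
    using Kr by (simp add: scalar_prod_def[of w] atLeast0LessThan del: index_mult_mat_vec)
  also have "\<dots> = (\<Sum>i<N. \<Sum>l<d. w $ (i * d + l) * (\<Sum>j<N. t ^ (1 + i + N * j) * r $ (j * d + l)))"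
    by (rule sum_div_mod)
  also have "\<dots> = (\<Sum>i<N. \<Sum>j<N. (\<Sum>l<d. w $ (i * d + l) * r $ (j * d + l)) * t ^ (1 + i + N * j))"
    unfolding sum_distrib_left sum_distrib_right
    by (subst (2) sum.swap) (simp add: mult_ac)
  also have "\<dots> = (\<Sum>i<N. \<Sum>j<N. (block_vec d w i \<bullet> block_vec d r j) * t ^ (1 + i + N * j))"
    by (simp add: block_vec_def scalar_prod_def atLeast0LessThan)
  finally show ?thesis .
qed

lemma kron_add_left:
  assumes "A \<in> carrier_mat n m" "B \<in> carrier_mat n m"
  shows "kron (A + B) D = kron A D + kron B D"
  using assms
  by (intro eq_matI) (auto simp: kron_def less_mult_imp_div_less algebra_simps)

lemma kron_smult_left: "kron (c \<cdot>\<^sub>m A) D = c \<cdot>\<^sub>m kron A D"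
  by (intro eq_matI) (auto simp: kron_def less_mult_imp_div_less algebra_simps)

lemma int_vecs_carrier: "r \<in> int_vecs m \<Longrightarrow> r \<in> carrier_vec m"
  by (simp add: int_vecs_def)

lemma int_vecs_minus: "r \<in> int_vecs m \<Longrightarrow> r' \<in> int_vecs m \<Longrightarrow> r - r' \<in> int_vecs m"
  by (auto simp: int_vecs_def)

lemma int_vecs_mult_mat_vec:
  assumes "C \<in> carrier_mat m m" "\<forall>i<m. \<forall>j<m. C $$ (i, j) \<in> \<int>" "r \<in> int_vecs m"
  shows "C *\<^sub>v r \<in> int_vecs m"
  using assms unfolding int_vecs_def by (auto simp: scalar_prod_def intro!: Ints_sum Ints_mult)

definition twist :: "nat \<Rightarrow> real \<Rightarrow> real mat" where
  "twist N t = 1\<^sub>m N + twist_mat N t"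

text \<open>The Sherman-Morrison inverse of the identity plus a rank-one matrix; the sum in the
  denominator is the trace of \<open>twist_mat N t\<close>.\<close>

definition untwist :: "nat \<Rightarrow> real \<Rightarrow> real mat" where
  "untwist N t = 1\<^sub>m N + (- 1 / (1 + (\<Sum>i<N. t ^ (1 + i + N * i)))) \<cdot>\<^sub>m twist_mat N t"

lemma twist_carrier [simp]: "twist N t \<in> carrier_mat N N" "untwist N t \<in> carrier_mat N N"
  by (simp_all add: twist_def untwist_def)

lemma twist_untwist:
  assumes "t > 0"
  shows "twist N t * untwist N t = 1\<^sub>m N" "untwist N t * twist N t = 1\<^sub>m N"
proof -
  let ?c = "\<Sum>i<N. t ^ (1 + i + N * i)" and ?M = "twist_mat N t"
  let ?a = "- 1 / (1 + ?c)"
  have "?c \<ge> 0" using assms by (intro sum_nonneg) simp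
  \<comment> \<open>This is the coefficient of \<open>twist_mat N t\<close> in the product of the
    two matrices.\<close>
  hence a: "1 + ?a + ?a * ?c = 0" by (simp add: field_simps)
  have aM: "?a \<cdot>\<^sub>m ?M \<in> carrier_mat N N" by simp
  have I: "1\<^sub>m N + ?M \<in> carrier_mat N N" by simp
  have "twist N t * untwist N t = (1\<^sub>m N + ?M) * 1\<^sub>m N + (1\<^sub>m N + ?M) * (?a \<cdot>\<^sub>m ?M)"
    unfolding twist_def untwist_def by (rule mult_add_distrib_mat[OF I _ aM]) simp
  also have "(1\<^sub>m N + ?M) * (?a \<cdot>\<^sub>m ?M) = ?a \<cdot>\<^sub>m ?M + ?M * (?a \<cdot>\<^sub>m ?M)"
    using add_mult_distrib_mat[of "1\<^sub>m N" N N ?M "?a \<cdot>\<^sub>m ?M" N] by simp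
  also have "?M * (?a \<cdot>\<^sub>m ?M) = ?a \<cdot>\<^sub>m (?c \<cdot>\<^sub>m ?M)"
    using mult_smult_distrib[of ?M N N ?M N ?a] by (simp add: twist_mat_square)
  also have "(1\<^sub>m N + ?M) * 1\<^sub>m N + (?a \<cdot>\<^sub>m ?M + ?a \<cdot>\<^sub>m (?c \<cdot>\<^sub>m ?M)) = 1\<^sub>m N"
  proof (rule eq_matI)
    fix i j assume "i < dim_row (1\<^sub>m N :: real mat)" "j < dim_col (1\<^sub>m N :: real mat)"
    hence ij: "i < N" "j < N" by auto
    have "((1\<^sub>m N + ?M) * 1\<^sub>m N + (?a \<cdot>\<^sub>m ?M + ?a \<cdot>\<^sub>m (?c \<cdot>\<^sub>m ?M))) $$ (i, j) =
        1\<^sub>m N $$ (i, j) + (1 + ?a + ?a * ?c) * ?M $$ (i, j)"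
      unfolding right_mult_one_mat[OF I] using ij by (simp add: algebra_simps)
    thus "((1\<^sub>m N + ?M) * 1\<^sub>m N + (?a \<cdot>\<^sub>m ?M + ?a \<cdot>\<^sub>m (?c \<cdot>\<^sub>m ?M))) $$ (i, j) = 1\<^sub>m N $$ (i, j)"
      unfolding a by simp
  qed simp_all
  finally show "twist N t * untwist N t = 1\<^sub>m N" .
  thus "untwist N t * twist N t = 1\<^sub>m N"
    using mat_mult_left_right_inverse[of "twist N t" N "untwist N t"] by simp
qed

lemma smult_mat_mult_vec:
  "dim_vec v = dim_col A \<Longrightarrow> (c \<cdot>\<^sub>m A) *\<^sub>v v = c \<cdot>\<^sub>v (A *\<^sub>v v)"
  by (rule eq_vecI) (simp_all add: scalar_prod_def sum_distrib_left mult.assoc)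

lemma kron_twist_mult_vec:
  assumes "r \<in> carrier_vec (N * d)"
  shows "kron (twist N t) (1\<^sub>m d) *\<^sub>v r = r + kron (twist_mat N t) (1\<^sub>m d) *\<^sub>v r"
    "kron (untwist N t) (1\<^sub>m d) *\<^sub>v r =
      r + (- 1 / (1 + (\<Sum>i<N. t ^ (1 + i + N * i)))) \<cdot>\<^sub>v (kron (twist_mat N t) (1\<^sub>m d) *\<^sub>v r)"
  unfolding twist_def untwist_def
  using assms add_mult_distrib_mat_vec[of "1\<^sub>m (N * d)" "N * d" "N * d" _ r]
  by (simp_all add: kron_add_left[of _ N N] kron_smult_left kron_one smult_mat_mult_vec)

text \<open>By Kronecker's theorem the line spanned by \<open>\<theta>\<close> comes close to an integer translate of any
  preimage of the target, and \<open>Z\<close> vanishes on that line.\<close>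

lemma dense_image_int_vecs:
  assumes Z: "Z \<in> carrier_mat k s" and Y: "Y \<in> carrier_mat s k" and ZY: "Z * Y = 1\<^sub>m k"
    and \<theta>: "\<theta> \<in> carrier_vec s" "Z *\<^sub>v \<theta> = 0\<^sub>v k"
    and indep: "\<And>z. z \<in> int_vecs s \<Longrightarrow> z \<noteq> 0\<^sub>v s \<Longrightarrow> z \<bullet> \<theta> \<noteq> 0"
    and x: "x \<in> carrier_vec k" and "\<epsilon> > 0"
  shows "\<exists>r\<in>int_vecs s. \<forall>i<k. \<bar>x $ i - (Z *\<^sub>v r) $ i\<bar> < \<epsilon>"
proof -
  \<comment> \<open>Independence in Kronecker's theorem is meant over the integers, with the reals
    as a module.\<close>
  interpret Modules.module "(\<lambda>r. (*) (real_of_int r))"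
    by (simp add: Modules.module.intro distrib_left mult.commute)
  have zsum: "z = 0\<^sub>v s" if "z \<in> int_vecs s" "(\<Sum>i < s. z $ i * \<theta> $ i) = 0" for z
    using indep[OF that(1)] that(2) \<theta>(1) by (auto simp: scalar_prod_def atLeast0LessThan)
  \<comment> \<open>The theorem asks for numbers without repetition; two equal coordinates would
    give a relation with coefficients 1 and -1.\<close>
  have inj: "inj_on (\<lambda>i. \<theta> $ i) {..<s}"
  proof (rule inj_onI, rule ccontr)
    fix i j assume ij: "i \<in> {..<s}" "j \<in> {..<s}" "\<theta> $ i = \<theta> $ j" "i \<noteq> j"
    define z :: "real vec" where "z = unit_vec s i - unit_vec s j"
    have "z \<in> int_vecs s" by (auto simp: z_def int_vecs_def unit_vec_def)
    moreover have "(\<Sum>l < s. z $ l * \<theta> $ l) = (\<Sum>l < s. (if l = i then \<theta> $ i else 0) - (if l = j then \<theta> $ j else 0))"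
      by (intro sum.cong) (auto simp: z_def unit_vec_def)
    ultimately have "z = 0\<^sub>v s" using ij by (intro zsum) (auto simp: sum_subtractf)
    hence "z $ i = 0" using ij by simp
    thus False using ij by (simp add: z_def)
  qed
  have ind: "independent ((\<lambda>i. \<theta> $ i) ` {..<s})"
  proof
    assume "dependent ((\<lambda>i. \<theta> $ i) ` {..<s})"
    then obtain T u v where T: "finite T" "T \<subseteq> (\<lambda>i. \<theta> $ i) ` {..<s}" "(\<Sum>v\<in>T. real_of_int (u v) * v) = 0"
      and v: "v \<in> T" "u v \<noteq> 0" unfolding dependent_explicit by blast
    define z where "z = vec s (\<lambda>i. if \<theta> $ i \<in> T then real_of_int (u (\<theta> $ i)) else 0)"
    have zc: "z \<in> int_vecs s" by (auto simp: z_def int_vecs_def)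
    define J where "J = {i. i < s \<and> \<theta> $ i \<in> T}"
    have TJ: "T = (\<lambda>i. \<theta> $ i) ` J" using T(2) by (auto simp: J_def)
    have "inj_on (\<lambda>i. \<theta> $ i) J" using inj by (rule inj_on_subset) (auto simp: J_def)
    hence "0 = (\<Sum>i\<in>J. real_of_int (u (\<theta> $ i)) * \<theta> $ i)"
      using T(3) unfolding TJ by (simp add: sum.reindex)
    also have "\<dots> = (\<Sum>i < s. z $ i * \<theta> $ i)"
      by (intro sum.mono_neutral_cong_left) (auto simp: J_def z_def)
    finally have "z = 0\<^sub>v s" using zsum[OF zc] by simp
    moreover obtain i where "i < s" "\<theta> $ i = v" using v(1) T(2) by auto
    ultimately have "z $ i = 0" by simp
    thus False using \<open>i < s\<close> \<open>\<theta> $ i = v\<close> v by (simp add: z_def)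
  qed
  define y where "y = Y *\<^sub>v x"
  \<comment> \<open>\<open>K\<close> bounds the sum of the absolute values in every row of
    \<open>Z\<close>; the summand 1 makes this bound strict and \<open>K\<close> positive.\<close>
  define K where "K = 1 + (\<Sum>i<k. \<Sum>j < s. \<bar>Z $$ (i, j)\<bar>)"
  have K: "K > 0" by (auto simp: K_def intro!: add_pos_nonneg sum_nonneg)
  \<comment> \<open>With target \<open>- y\<close> the integers \<open>h i\<close> approximate t
    \<theta> + y in every coordinate, so that \<open>Z\<close> maps them close to
    \<open>Z *\<^sub>v y = x\<close>.\<close>
  obtain t h where th: "\<And>i. i < s \<Longrightarrow> \<bar>t * \<theta> $ i - of_int (h i) - (- y $ i)\<bar> < \<epsilon> / K"
    using Kronecker_thm_1[OF ind inj, of "\<epsilon> / K" "\<lambda>i. - y $ i"] K \<open>\<epsilon> > 0\<close> by (auto simp: field_simps)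
  define r where "r = vec s (\<lambda>i. real_of_int (h i))"
  have y: "y \<in> carrier_vec s" and Zy: "Z *\<^sub>v y = x"
    using Y x Z assoc_mult_mat_vec[OF Z Y x] by (simp_all add: y_def ZY)
  have "\<bar>x $ i - (Z *\<^sub>v r) $ i\<bar> < \<epsilon>" if i: "i < k" for i
  proof -
    have "(Z *\<^sub>v \<theta>) $ i = (\<Sum>j < s. Z $$ (i, j) * \<theta> $ j)"
      using Z \<theta>(1) i by (simp add: scalar_prod_def atLeast0LessThan)
    hence \<theta>0: "(\<Sum>j < s. Z $$ (i, j) * \<theta> $ j) = 0" using \<theta>(2) i by simp
    have "x $ i - (Z *\<^sub>v r) $ i = (\<Sum>j < s. Z $$ (i, j) * y $ j) - (\<Sum>j < s. Z $$ (i, j) * real_of_int (h j))"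
      using Z y i unfolding Zy[symmetric] by (simp add: r_def scalar_prod_def atLeast0LessThan)
    also have "\<dots> = (\<Sum>j < s. Z $$ (i, j) * y $ j) - (\<Sum>j < s. Z $$ (i, j) * real_of_int (h j)) +
        t * (\<Sum>j < s. Z $$ (i, j) * \<theta> $ j)" by (simp add: \<theta>0)
    also have "\<dots> = (\<Sum>j < s. Z $$ (i, j) * (t * \<theta> $ j - of_int (h j) - (- y $ j)))"
      by (simp add: sum_distrib_left sum_subtractf[symmetric] sum.distrib[symmetric] algebra_simps)
    finally have "\<bar>x $ i - (Z *\<^sub>v r) $ i\<bar> \<le> (\<Sum>j < s. \<bar>Z $$ (i, j)\<bar> * \<bar>t * \<theta> $ j - of_int (h j) - (- y $ j)\<bar>)"
      by (simp only: abs_mult[symmetric] sum_abs)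
    also have "\<dots> \<le> (\<Sum>j < s. \<bar>Z $$ (i, j)\<bar> * (\<epsilon> / K))"
      by (intro sum_mono mult_left_mono less_imp_le[OF th]) auto
    also have "\<dots> = (\<Sum>j < s. \<bar>Z $$ (i, j)\<bar>) * (\<epsilon> / K)" by (simp only: sum_distrib_right)
    also have "(\<Sum>j < s. \<bar>Z $$ (i, j)\<bar>) < K"
    proof -
      have "(\<Sum>j < s. \<bar>Z $$ (i, j)\<bar>) \<le> (\<Sum>i<k. \<Sum>j < s. \<bar>Z $$ (i, j)\<bar>)"
        using i by (intro member_le_sum) (auto intro!: sum_nonneg)
      thus ?thesis by (simp add: K_def)
    qed
    hence "(\<Sum>j < s. \<bar>Z $$ (i, j)\<bar>) * (\<epsilon> / K) < K * (\<epsilon> / K)"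
      using K \<open>\<epsilon> > 0\<close> by (intro mult_strict_right_mono) auto
    also have "K * (\<epsilon> / K) = \<epsilon>" using K by simp
    finally show ?thesis .
  qed
  moreover have "r \<in> int_vecs s" by (simp add: r_def int_vecs_def)
  ultimately show ?thesis by blast
qed

text \<open>After multiplication by the denominator 1 + c of \<open>untwist\<close>, the scalar
  product is a polynomial in t. The powers of t in c are the diagonal ones of the grid, so the term
  c (z . u) only alters the coefficients with i = j. If z and u are orthogonal, this term vanishes
  and the given pair of blocks provides a non-zero coefficient; otherwise the constant coefficient
  is non-zero.\<close>

lemma untwist_scalar_prod_nz:
  assumes z: "z \<in> carrier_vec (N * d)" and u: "u \<in> carrier_vec (N * d)"
    and ij: "i < N" "j < N" "block_vec d z i \<bullet> block_vec d u j \<noteq> 0"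
  shows "\<exists>p. p \<noteq> 0 \<and> (\<forall>t>0. poly p t \<noteq> 0 \<longrightarrow> z \<bullet> (kron (untwist N t) (1\<^sub>m d) *\<^sub>v u) \<noteq> 0)"
proof -
  let ?e = "\<lambda>i j. of_bool (i = j) * (z \<bullet> u) - block_vec d z i \<bullet> block_vec d u j"
  have "z \<bullet> u \<noteq> 0 \<or> (\<exists>i<N. \<exists>j<N. ?e i j \<noteq> 0)"
  proof (cases "z \<bullet> u = 0")
    case True
    hence "?e i j \<noteq> 0" using ij(3) by simp
    thus ?thesis using ij(1,2) by blast
  qed simp
  then obtain p where p: "p \<noteq> 0" "\<And>t. poly p t = z \<bullet> u + (\<Sum>i<N. \<Sum>j<N. ?e i j * t ^ (1 + i + N * j))"
    using grid_poly[of "z \<bullet> u" N ?e] by blast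
  have "poly p t = (1 + (\<Sum>i<N. t ^ (1 + i + N * i))) * (z \<bullet> (kron (untwist N t) (1\<^sub>m d) *\<^sub>v u))"
    if "t > 0" for t
  proof -
    define c where "c = (\<Sum>i<N. t ^ (1 + i + N * i))"
    define v where "v = kron (twist_mat N t) (1\<^sub>m d) *\<^sub>v u"
    have "c \<ge> 0" unfolding c_def using that by (intro sum_nonneg) simp
    have v: "v \<in> carrier_vec (N * d)" unfolding v_def by (rule mult_mat_vec_carrier[OF _ u]) simp
    have "z \<bullet> (kron (untwist N t) (1\<^sub>m d) *\<^sub>v u) = z \<bullet> (u + (- 1 / (1 + c)) \<cdot>\<^sub>v v)"
      unfolding kron_twist_mult_vec(2)[OF u] c_def v_def ..
    also have "\<dots> = z \<bullet> u + (- 1 / (1 + c)) * (z \<bullet> v)"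
      using scalar_prod_add_distrib[OF z u smult_carrier_vec[THEN iffD2, OF v]] scalar_prod_smult_distrib[OF z v]
      by simp
    finally have "(1 + c) * (z \<bullet> (kron (untwist N t) (1\<^sub>m d) *\<^sub>v u)) = (1 + c) * (z \<bullet> u) - z \<bullet> v"
      using \<open>c \<ge> 0\<close> by (simp add: field_simps)
    moreover have "(\<Sum>i<N. \<Sum>j<N. ?e i j * t ^ (1 + i + N * j)) = c * (z \<bullet> u) - z \<bullet> v"
    proof -
      have "(\<Sum>i<N. \<Sum>j<N. of_bool (i = j) * (z \<bullet> u) * t ^ (1 + i + N * j)) =
          (\<Sum>i<N. \<Sum>j<N. if j = i then (z \<bullet> u) * t ^ (1 + i + N * i) else 0)"
        by (intro sum.cong) auto
      also have "\<dots> = c * (z \<bullet> u)" by (simp add: c_def sum_distrib_left mult.commute)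
      finally show ?thesis
        unfolding v_def scalar_prod_kron_twist[OF z u] by (simp only: left_diff_distrib sum_subtractf)
    qed
    ultimately show ?thesis unfolding p(2) c_def[symmetric] by (simp only:) (simp add: algebra_simps)
  qed
  thus ?thesis using p(1) by auto
qed

section \<open>Non-vanishing statements obtained from cyclic vectors\<close>

context min_poly_Q
begin

abbreviation Cr :: "real mat" where "Cr \<equiv> companion (map_poly of_rat f)"

lemma Cr_carrier: "Cr \<in> carrier_mat (degree f) (degree f)"
  using companion_carrier[of "map_poly of_rat f :: real poly"] by simp

lemma det_cyclic_Cr:
  assumes "q \<in> int_vecs (degree f)" "q \<noteq> 0\<^sub>v (degree f)"
  shows "det (cyclic_mat Cr q) \<noteq> 0" "det (cyclic_mat (transpose_mat Cr) q) \<noteq> 0"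
proof -
  let ?r = "of_rat :: rat \<Rightarrow> real"
  obtain q' where q': "q' \<in> carrier_vec (degree f)" "q = map_vec ?r q'"
    using int_vecs_of_rat[OF assms(1)] .
  have nz: "q' \<noteq> 0\<^sub>v (degree f)" using q' assms(2) by auto
  have Cr: "Cr = map_mat ?r (companion f)" by (simp add: of_rat_hom.companion_hom)
  have "cyclic_mat Cr q = map_mat ?r (cyclic_mat (companion f) q')"
    "cyclic_mat (transpose_mat Cr) q = map_mat ?r (cyclic_mat (transpose_mat (companion f)) q')"
    unfolding Cr q'(2) map_mat_transpose
    by (rule of_rat_hom.cyclic_mat_hom[symmetric, OF _ q'(1)], simp)+
  thus "det (cyclic_mat Cr q) \<noteq> 0" "det (cyclic_mat (transpose_mat Cr) q) \<noteq> 0"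
    using det_cyclic_companion[OF q'(1) nz] det_cyclic_companion_transpose[OF q'(1) nz]
    by (simp_all add: of_rat_hom.hom_det)
qed

text \<open>A non-zero column block \<open>i\<close> of \<open>R\<close> intertwines with a single
  companion matrix, so it cannot kill a non-zero block \<open>j\<close> of \<open>r\<close>, which
  is cyclic. The indices \<open>i\<close> and \<open>j\<close> may differ, which is why the twist
  has to link every pair of blocks.\<close>

lemma block_scalar_prod_nz:
  assumes R: "R \<in> carrier_mat k (N * degree f)" and B: "B \<in> carrier_mat k k"
    and BR: "B * R = R * kron (1\<^sub>m N) Cr" and "R \<noteq> 0\<^sub>m k (N * degree f)"
    and r: "r \<in> int_vecs (N * degree f)" "r \<noteq> 0\<^sub>v (N * degree f)"
  obtains a i j where "a < k" "i < N" "j < N"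
    "block_vec (degree f) (row R a) i \<bullet> block_vec (degree f) r j \<noteq> 0"
proof -
  let ?d = "degree f"
  obtain i where i: "i < N" "R * block_col N ?d i \<noteq> 0\<^sub>m k ?d"
    using mult_block_col_nz[OF R assms(4)] .
  obtain j where j: "j < N" "block_vec ?d r j \<noteq> 0\<^sub>v ?d"
    using block_vec_nz[OF int_vecs_carrier[OF r(1)] r(2)] .
  let ?Ri = "R * block_col N ?d i"
  have Ri: "?Ri \<in> carrier_mat k ?d" using mult_carrier_mat[OF R block_col_carrier] .
  have C: "kron (1\<^sub>m N) Cr \<in> carrier_mat (N * ?d) (N * ?d)" using Cr_carrier by simp
  have BRi: "B * ?Ri = ?Ri * Cr"
    by (rule intertwine_mult[OF B C Cr_carrier R block_col_carrier BR block_col_intertwine[OF Cr_carrier]])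
  have "?Ri *\<^sub>v block_vec ?d r j \<noteq> 0\<^sub>v k"
    using cyclic_mat_kernel[OF Cr_carrier Ri B BRi block_vec_carrier] i(2)
      det_cyclic_Cr(1)[OF block_vec_int[OF r(1) j(1)] j(2)] by blast
  moreover have "dim_vec (?Ri *\<^sub>v block_vec ?d r j) = k" using carrier_matD(1)[OF Ri] by simp
  ultimately have "\<exists>a<k. (?Ri *\<^sub>v block_vec ?d r j) $ a \<noteq> 0\<^sub>v k $ a"
    by (metis eq_vecI index_zero_vec(2))
  then obtain a where a: "a < k" "(?Ri *\<^sub>v block_vec ?d r j) $ a \<noteq> 0"
    by (metis index_zero_vec(1))
  have "row ?Ri a = block_vec ?d (row R a) i"
  proof (rule eq_vecI)
    fix l assume "l < dim_vec (block_vec ?d (row R a) i)"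
    hence l: "l < ?d" by (simp add: block_vec_def)
    thus "row ?Ri a $ l = block_vec ?d (row R a) i $ l"
      using a(1) R Ri i(1) mult_block_col[OF R a(1) l i(1)] block_index_less[OF i(1) l]
      by (simp add: block_vec_def del: index_mult_mat(1))
  qed (simp add: block_vec_def)
  hence "block_vec ?d (row R a) i \<bullet> block_vec ?d r j \<noteq> 0"
    using a carrier_matD[OF Ri] by simp
  thus ?thesis using that a(1) i(1) j(1) by blast
qed

text \<open>Coordinate \<open>a\<close> of the image is a polynomial in t whose coefficient at
  t^(1+i+Nj) is the non-zero product found for the blocks \<open>i\<close> and \<open>j\<close>.
  Applied to both projections.\<close>

lemma twist_image_nz:
  assumes R: "R \<in> carrier_mat k (N * degree f)" and B: "B \<in> carrier_mat k k"
    and BR: "B * R = R * kron (1\<^sub>m N) Cr" and "R \<noteq> 0\<^sub>m k (N * degree f)"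
    and r: "r \<in> int_vecs (N * degree f)" "r \<noteq> 0\<^sub>v (N * degree f)"
  shows "\<exists>p. p \<noteq> 0 \<and> (\<forall>t. poly p t \<noteq> 0 \<longrightarrow> R *\<^sub>v (kron (twist N t) (1\<^sub>m (degree f)) *\<^sub>v r) \<noteq> 0\<^sub>v k)"
proof -
  let ?d = "degree f"
  have rc: "r \<in> carrier_vec (N * ?d)" using r(1) by (rule int_vecs_carrier)
  obtain a i j where a: "a < k" and ij: "i < N" "j < N" "block_vec ?d (row R a) i \<bullet> block_vec ?d r j \<noteq> 0"
    using block_scalar_prod_nz[OF assms] .
  obtain p where p: "p \<noteq> 0" "\<And>t. poly p t = row R a \<bullet> r +
      (\<Sum>i<N. \<Sum>j<N. (block_vec ?d (row R a) i \<bullet> block_vec ?d r j) * t ^ (1 + i + N * j))"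
    using grid_poly[of "row R a \<bullet> r" N "\<lambda>i j. block_vec ?d (row R a) i \<bullet> block_vec ?d r j"] ij by blast
  have w: "row R a \<in> carrier_vec (N * ?d)" using row_carrier_vec[OF a R] .
  have "(R *\<^sub>v (kron (twist N t) (1\<^sub>m ?d) *\<^sub>v r)) $ a = poly p t" for t
  proof -
    have v: "kron (twist_mat N t) (1\<^sub>m ?d) *\<^sub>v r \<in> carrier_vec (N * ?d)"
      by (rule mult_mat_vec_carrier[OF _ rc]) simp
    have "(R *\<^sub>v (kron (twist N t) (1\<^sub>m ?d) *\<^sub>v r)) $ a =
        row R a \<bullet> (r + kron (twist_mat N t) (1\<^sub>m ?d) *\<^sub>v r)"
      using R a kron_twist_mult_vec(1)[OF rc] by simp
    also have "\<dots> = row R a \<bullet> r + row R a \<bullet> (kron (twist_mat N t) (1\<^sub>m ?d) *\<^sub>v r)"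
      by (rule scalar_prod_add_distrib[OF w rc v])
    finally show ?thesis using scalar_prod_kron_twist[OF w rc] p(2) by simp
  qed
  hence "poly p t = 0" if "R *\<^sub>v (kron (twist N t) (1\<^sub>m ?d) *\<^sub>v r) = 0\<^sub>v k" for t
    using a that by (metis index_zero_vec(1))
  thus ?thesis using p(1) by blast
qed

text \<open>Supplies a vector in the image of \<open>S\<close> that has one block with rationally
  independent coordinates. Transposed, block \<open>j\<close> of \<open>S\<close> becomes an
  intertwiner for the transposed companion matrix, so it kills no non-zero integer vector
  \<open>q\<close>; it remains to choose \<open>v\<close> off the countably many hyperplanes
  orthogonal to the vectors \<open>?R *\<^sub>v q\<close>.\<close>

lemma exists_block_generic:
  assumes S: "S \<in> carrier_mat (N * degree f) n" and A: "A \<in> carrier_mat n n"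
    and CS: "kron (1\<^sub>m N) Cr * S = S * A" and "S \<noteq> 0\<^sub>m (N * degree f) n"
  obtains v where "v \<in> carrier_vec n"
    "\<And>z. z \<in> int_vecs (N * degree f) \<Longrightarrow> z \<noteq> 0\<^sub>v (N * degree f) \<Longrightarrow>
      \<exists>i<N. \<exists>j<N. block_vec (degree f) z i \<bullet> block_vec (degree f) (S *\<^sub>v v) j \<noteq> 0"
proof -
  let ?d = "degree f"
  let ?C = "kron (1\<^sub>m N) Cr" and ?b = "block_col N ?d :: nat \<Rightarrow> real mat"
  have C: "?C \<in> carrier_mat (N * ?d) (N * ?d)" using Cr_carrier by simp
  have ST: "transpose_mat S \<in> carrier_mat n (N * ?d)" using S by simp
  have "transpose_mat S \<noteq> 0\<^sub>m n (N * ?d)"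
  proof
    assume "transpose_mat S = 0\<^sub>m n (N * ?d)"
    hence "S = transpose_mat (0\<^sub>m n (N * ?d))" using Matrix.transpose_transpose[of S] by simp
    also have "\<dots> = 0\<^sub>m (N * ?d) n" by (intro eq_matI) auto
    finally show False using assms(4) by simp
  qed
  then obtain j where j: "j < N" "transpose_mat S * ?b j \<noteq> 0\<^sub>m n ?d"
    using mult_block_col_nz[OF ST] by blast
  let ?R = "transpose_mat S * ?b j"
  have R: "?R \<in> carrier_mat n ?d" using mult_carrier_mat[OF ST block_col_carrier] .
  have CT: "transpose_mat Cr \<in> carrier_mat ?d ?d" and AT: "transpose_mat A \<in> carrier_mat n n"
    and C': "kron (1\<^sub>m N) (transpose_mat Cr) \<in> carrier_mat (N * ?d) (N * ?d)"
    using Cr_carrier A by auto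
  have "transpose_mat ?C = kron (1\<^sub>m N) (transpose_mat Cr)"
    using Cr_carrier by (intro eq_matI) (auto simp: kron_def less_mult_imp_div_less mod_less_mult)
  hence "transpose_mat A * transpose_mat S = transpose_mat S * kron (1\<^sub>m N) (transpose_mat Cr)"
    using arg_cong[OF CS, of transpose_mat] transpose_mult[OF C S] transpose_mult[OF S A] by simp
  hence AR: "transpose_mat A * ?R = ?R * transpose_mat Cr"
    by (rule intertwine_mult[OF AT C' CT ST block_col_carrier _ block_col_intertwine[OF CT]])
  have nz: "?R *\<^sub>v q \<noteq> 0\<^sub>v n" if "q \<in> int_vecs ?d" "q \<noteq> 0\<^sub>v ?d" for q
    using cyclic_mat_kernel[OF CT R AT AR int_vecs_carrier[OF that(1)]] j(2) det_cyclic_Cr(2)[OF that] by blast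
  have "\<exists>t>0. \<forall>q\<in>int_vecs ?d - {0\<^sub>v ?d}. poly (poly_of_vec (?R *\<^sub>v q)) t \<noteq> 0"
  proof (rule exists_generic_parameter)
    show "countable (int_vecs ?d - {0\<^sub>v ?d})" using countable_int_vecs by simp
    fix q assume q: "q \<in> int_vecs ?d - {0\<^sub>v ?d}"
    hence "poly_of_vec (?R *\<^sub>v q) \<noteq> 0"
      using nz mult_mat_vec_carrier[OF R int_vecs_carrier] by (intro poly_of_vec_nz) auto
    thus "\<exists>p. p \<noteq> 0 \<and> (\<forall>t>0. poly p t \<noteq> 0 \<longrightarrow> poly (poly_of_vec (?R *\<^sub>v q)) t \<noteq> 0)" by blast
  qed
  then obtain t where t: "\<And>q. q \<in> int_vecs ?d \<Longrightarrow> q \<noteq> 0\<^sub>v ?d \<Longrightarrow> poly (poly_of_vec (?R *\<^sub>v q)) t \<noteq> 0"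
    by blast
  \<comment> \<open>A point of the moment curve: its scalar product with a vector is the value at t
    of the polynomial with these coefficients, so one parameter avoids all the hyperplanes.\<close>
  define v where "v = vec n (\<lambda>l. t ^ l)"
  have v: "v \<in> carrier_vec n" by (simp add: v_def)
  have Sv: "S *\<^sub>v v \<in> carrier_vec (N * ?d)" using S v by simp
  show ?thesis
  proof (rule that[OF v])
    fix z assume z: "z \<in> int_vecs (N * ?d)" "z \<noteq> 0\<^sub>v (N * ?d)"
    obtain i where i: "i < N" "block_vec ?d z i \<noteq> 0\<^sub>v ?d"
      using block_vec_nz[OF int_vecs_carrier[OF z(1)] z(2)] .
    let ?q = "block_vec ?d z i"
    have q: "?q \<in> int_vecs ?d" using block_vec_int z(1) i(1) .
    have "block_vec ?d (S *\<^sub>v v) j = transpose_mat (?b j) *\<^sub>v (S *\<^sub>v v)"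
      using block_col_transpose_mult_vec[OF Sv j(1)] by simp
    also have "\<dots> = transpose_mat (?b j) * S *\<^sub>v v"
      using assoc_mult_mat_vec[OF _ S v, of "transpose_mat (?b j)" ?d] by simp
    also have "transpose_mat (?b j) * S = transpose_mat ?R"
      using transpose_mult[OF ST block_col_carrier] by simp
    finally have "?q \<bullet> block_vec ?d (S *\<^sub>v v) j = ?q \<bullet> (transpose_mat ?R *\<^sub>v v)" by simp
    also have "\<dots> = (?R *\<^sub>v ?q) \<bullet> v"
      using transpose_vec_mult_scalar[of "transpose_mat ?R" ?d n v ?q] R v by simp
    also have "\<dots> = poly (poly_of_vec (?R *\<^sub>v ?q)) t"
      using carrier_matD[OF S]
      by (simp add: poly_poly_of_vec scalar_prod_def v_def atLeast0LessThan del: index_mult_mat_vec)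
    finally have "?q \<bullet> block_vec ?d (S *\<^sub>v v) j \<noteq> 0" using t[OF q i(2)] by simp
    thus "\<exists>i<N. \<exists>j<N. block_vec ?d z i \<bullet> block_vec ?d (S *\<^sub>v v) j \<noteq> 0" using i(1) j(1) by blast
  qed
qed

end

section \<open>From two row blocks to a generic scheme\<close>

lemma four_block_diag_mult_append_rows:
  fixes A B X Y :: "'a :: comm_ring_1 mat"
  assumes "A \<in> carrier_mat n n" "B \<in> carrier_mat k k" "X \<in> carrier_mat n s" "Y \<in> carrier_mat k s"
  shows "four_block_mat A (0\<^sub>m n k) (0\<^sub>m k n) B * (X @\<^sub>r Y) = (A * X) @\<^sub>r (B * Y)"
  unfolding append_rows_def using assms
  by (subst mult_four_block_mat[of _ n n _ k _ k _ _ s _ 0]) auto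

lemma proj_append_rows_mult:
  assumes "X \<in> carrier_mat n s" "Y \<in> carrier_mat k s" "r \<in> carrier_vec s"
  shows "proj_par n ((X @\<^sub>r Y) *\<^sub>v r) = X *\<^sub>v r" "proj_perp n ((X @\<^sub>r Y) *\<^sub>v r) = Y *\<^sub>v r"
  unfolding mat_mult_append[OF assms] proj_par_def proj_perp_def using assms
  by (auto intro!: eq_vecI)

lemma lattice_int_vecs: "L \<in> carrier_mat m s \<Longrightarrow> lattice L = (\<lambda>r. L *\<^sub>v r) ` int_vecs s"
  by (auto simp: lattice_def int_vecs_def)

lemma inj_on_int_vecs_mult:
  assumes "X \<in> carrier_mat k s" and "\<And>r. r \<in> int_vecs s \<Longrightarrow> r \<noteq> 0\<^sub>v s \<Longrightarrow> X *\<^sub>v r \<noteq> 0\<^sub>v k"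
  shows "inj_on (\<lambda>r. X *\<^sub>v r) (int_vecs s)"
proof (rule inj_onI)
  fix r r' assume r: "r \<in> int_vecs s" "r' \<in> int_vecs s" "X *\<^sub>v r = X *\<^sub>v r'"
  note c = int_vecs_carrier[OF r(1)] int_vecs_carrier[OF r(2)]
  have "X *\<^sub>v (r - r') = X *\<^sub>v r - X *\<^sub>v r'"
    using mult_minus_distrib_mat_vec[OF assms(1) c] .
  also have "\<dots> = 0\<^sub>v k" using r(3) assms(1) by (intro eq_vecI) auto
  finally have "r - r' = 0\<^sub>v s" using assms(2)[OF int_vecs_minus[OF r(1,2)]] by blast
  hence "r $ i - r' $ i = 0" if "i < s" for i
    using that c by (metis carrier_vecD index_minus_vec(1) index_zero_vec(1))
  thus "r = r'" using c by (intro eq_vecI) auto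
qed

text \<open>Everything is reduced to integer vectors: \<open>X\<close> and \<open>Y\<close> are the
  two projections in lattice coordinates, and \<open>A\<close> preserves the projected lattice
  because \<open>C\<close> preserves integer vectors.\<close>

lemma self_similarityI:
  assumes A: "A \<in> carrier_mat n n" and B: "B \<in> carrier_mat (s - n) (s - n)"
    and X: "X \<in> carrier_mat n s" and Y: "Y \<in> carrier_mat (s - n) s" and C: "C \<in> carrier_mat s s"
    and n: "1 \<le> n" "n < s" and det: "det (X @\<^sub>r Y) \<noteq> 0"
    and Cint: "\<forall>i < s. \<forall>j < s. C $$ (i, j) \<in> \<int>"
    and AX: "A * X = X * C" and BY: "B * Y = Y * C"
    and injX: "\<And>r. r \<in> int_vecs s \<Longrightarrow> r \<noteq> 0\<^sub>v s \<Longrightarrow> X *\<^sub>v r \<noteq> 0\<^sub>v n"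
    and injY: "\<And>r. r \<in> int_vecs s \<Longrightarrow> r \<noteq> 0\<^sub>v s \<Longrightarrow> Y *\<^sub>v r \<noteq> 0\<^sub>v (s - n)"
    and dense: "\<And>x \<epsilon>. x \<in> carrier_vec (s - n) \<Longrightarrow> \<epsilon> > 0 \<Longrightarrow>
      \<exists>r\<in>int_vecs s. \<forall>i < s - n. \<bar>x $ i - (Y *\<^sub>v r) $ i\<bar> < \<epsilon>"
  shows "self_similarity s n (X @\<^sub>r Y) A"
proof -
  let ?L = "X @\<^sub>r Y"
  have L: "?L \<in> carrier_mat s s" using carrier_append_rows[OF X Y] n by simp
  note lat = lattice_int_vecs[OF L]
  have proj: "proj_par n (?L *\<^sub>v r) = X *\<^sub>v r" "proj_perp n (?L *\<^sub>v r) = Y *\<^sub>v r" if "r \<in> int_vecs s" for r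
    using proj_append_rows_mult[OF X Y int_vecs_carrier[OF that]] by auto
  have "cps s n ?L" using n L det by (simp add: cps_def)
  moreover have "inj_on (proj_par n) (lattice ?L)"
    using inj_on_int_vecs_mult[OF X injX] unfolding lat by (auto simp: inj_on_def proj)
  moreover have "inj_on (proj_perp n) (lattice ?L)"
    using inj_on_int_vecs_mult[OF Y injY] unfolding lat by (auto simp: inj_on_def proj)
  moreover have "dense_in_Rk (s - n) (proj_perp n ` lattice ?L)"
    unfolding dense_in_Rk_def lat using dense by (force simp: proj)
  ultimately have "generic_cps s n ?L" by (simp add: generic_cps_def)
  moreover have "A *\<^sub>v x \<in> proj_par n ` lattice ?L" if xin: "x \<in> proj_par n ` lattice ?L" for x
  proof -
    obtain r where r: "r \<in> int_vecs s" "x = proj_par n (?L *\<^sub>v r)" using xin unfolding lat by blast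
    hence x: "x = X *\<^sub>v r" by (simp add: proj)
    have rc: "r \<in> carrier_vec s" using r(1) by (rule int_vecs_carrier)
    have Cr: "C *\<^sub>v r \<in> int_vecs s" by (rule int_vecs_mult_mat_vec[OF C Cint r(1)])
    have "A *\<^sub>v x = X *\<^sub>v (C *\<^sub>v r)"
      unfolding x using assoc_mult_mat_vec[OF A X rc] assoc_mult_mat_vec[OF X C rc] AX by simp
    also have "\<dots> = proj_par n (?L *\<^sub>v (C *\<^sub>v r))" by (simp add: proj(1)[OF Cr])
    finally show ?thesis unfolding lat using Cr by blast
  qed
  moreover have "four_block_mat A (0\<^sub>m n (s - n)) (0\<^sub>m (s - n) n) B * ?L = ?L * C"
    unfolding four_block_diag_mult_append_rows[OF A B X Y] append_rows_mult[OF X Y C] AX BY ..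
  ultimately show ?thesis unfolding self_similarity_def using A B C Cint by blast
qed

context min_poly_Q
begin

text \<open>\<open>N\<close> is only required to bound the multiplicities and to leave room for a
  perpendicular part, so that one statement serves both cases of the theorem.\<close>

lemma exists_self_similarity:
  fixes A :: "real mat"
  defines "T \<equiv> map_mat complex_of_real A"
  assumes A: "A \<in> carrier_mat n n" and diag: "diagonalizable_C T"
    and ev: "eigenvalues_C T \<subseteq> roots_C f" and N: "\<And>z. alg_mult T z \<le> N"
    and n: "1 \<le> n" "n < N * degree f" and int: "\<And>i. poly.coeff f i \<in> \<int>"
  shows "\<exists>L. self_similarity (N * degree f) n L A"
proof -
  let ?d = "degree f"
  define s where "s = N * ?d"
  define k where "k = s - n"
  define C where "C = kron (1\<^sub>m N) Cr"
  have ns: "n < s" "n \<le> s" "k > 0" "n + k = s" using n by (auto simp: s_def k_def)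
  have C: "C \<in> carrier_mat s s" unfolding C_def s_def using Cr_carrier by simp
  obtain P S where P: "P \<in> carrier_mat n s" and S: "S \<in> carrier_mat s n"
    and AP: "A * P = P * C" and CS: "C * S = S * A" and PS: "P * S = 1\<^sub>m n"
    using real_intertwiner[OF A diag[unfolded T_def] ev[unfolded T_def] N[unfolded T_def]]
    unfolding s_def C_def by blast
  obtain Z Y where Z: "Z \<in> carrier_mat k s" and Y: "Y \<in> carrier_mat s k"
    and PY: "P * Y = 0\<^sub>m n k" and ZS: "Z * S = 0\<^sub>m k n" and ZY: "Z * Y = 1\<^sub>m k" and one: "S * P + Y * Z = 1\<^sub>m s"
    using right_inverse_complement[OF P S PS ns(2)] unfolding k_def by blast
  \<comment> \<open>The compression of \<open>C\<close> to the complement. It satisfies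
    \<open>B * Z = Z * C\<close> because the image of \<open>S\<close> is invariant under
    \<open>C\<close> and killed by \<open>Z\<close>.\<close>
  define B where "B = Z * C * Y"
  have ZC: "Z * C \<in> carrier_mat k s" using Z C by simp
  have B: "B \<in> carrier_mat k k" unfolding B_def using ZC Y by simp
  have BZ: "B * Z = Z * C"
  proof -
    have "Z * C = Z * C * (S * P + Y * Z)" unfolding one right_mult_one_mat[OF ZC] ..
    also have "\<dots> = Z * C * (S * P) + Z * C * (Y * Z)"
      using mult_add_distrib_mat[OF ZC mult_carrier_mat[OF S P] mult_carrier_mat[OF Y Z]] .
    also have "Z * C * (S * P) = Z * (C * S) * P"
      using assoc_mult_mat[OF ZC S P] assoc_mult_mat[OF Z C S] by simp
    also have "Z * (C * S) = 0\<^sub>m k n * A"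
      using assoc_mult_mat[OF Z S A] by (simp add: CS ZS)
    also have "0\<^sub>m k n * A * P = 0\<^sub>m k s" using A P by simp
    also have "Z * C * (Y * Z) = B * Z" using assoc_mult_mat[OF ZC Y Z] by (simp add: B_def)
    finally show ?thesis using mult_carrier_mat[OF B Z] by simp
  qed
  have Pnz: "P \<noteq> 0\<^sub>m n s" and Snz: "S \<noteq> 0\<^sub>m s n"
  proof -
    have "(1\<^sub>m n :: real mat) \<noteq> 0\<^sub>m n n"
      using n by (metis One_nat_def Suc_le_eq index_one_mat(1) index_zero_mat(1) zero_neq_one)
    thus "P \<noteq> 0\<^sub>m n s" "S \<noteq> 0\<^sub>m s n" using PS P S by auto
  qed
  have Znz: "Z \<noteq> 0\<^sub>m k s"
  proof -
    have "(1\<^sub>m k :: real mat) \<noteq> 0\<^sub>m k k"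
      using ns by (metis index_one_mat(1) index_zero_mat(1) zero_neq_one)
    thus ?thesis using ZY Y by auto
  qed
  obtain v where v: "v \<in> carrier_vec n"
    and block: "\<And>z. z \<in> int_vecs s \<Longrightarrow> z \<noteq> 0\<^sub>v s \<Longrightarrow>
      \<exists>i<N. \<exists>j<N. block_vec ?d z i \<bullet> block_vec ?d (S *\<^sub>v v) j \<noteq> 0"
    using exists_block_generic[OF S[unfolded s_def] A CS[unfolded C_def] Snz[unfolded s_def]]
    unfolding s_def by blast
  \<comment> \<open>\<open>u\<close> lies in the image of \<open>S\<close>, hence in the kernel of
    \<open>Z\<close>. The twist replaces \<open>Z\<close> by \<open>Z * W t\<close>, whose kernel
    contains \<open>W' t *\<^sub>v u\<close>; the third condition on t below makes this vector
    rationally independent.\<close>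
  define u where "u = S *\<^sub>v v"
  have u: "u \<in> carrier_vec s" unfolding u_def using S v by simp
  have Zu: "Z *\<^sub>v u = 0\<^sub>v k"
  proof -
    have "0\<^sub>m k n *\<^sub>v v = 0\<^sub>v k" using v by (intro eq_vecI) auto
    thus ?thesis unfolding u_def using assoc_mult_mat_vec[OF Z S v] by (simp add: ZS)
  qed
  define W where "W t = kron (twist N t) (1\<^sub>m ?d)" for t
  define W' where "W' t = kron (untwist N t) (1\<^sub>m ?d)" for t
  have W: "W t \<in> carrier_mat s s" "W' t \<in> carrier_mat s s" for t
    by (simp_all add: W_def W'_def s_def)
  have "\<exists>t>0. \<forall>r\<in>int_vecs s - {0\<^sub>v s}.
      P *\<^sub>v (W t *\<^sub>v r) \<noteq> 0\<^sub>v n \<and> Z *\<^sub>v (W t *\<^sub>v r) \<noteq> 0\<^sub>v k \<and> r \<bullet> (W' t *\<^sub>v u) \<noteq> 0"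
  proof (rule exists_generic_parameter)
    show "countable (int_vecs s - {0\<^sub>v s})" using countable_int_vecs by simp
    fix r assume "r \<in> int_vecs s - {0\<^sub>v s}"
    hence r: "r \<in> int_vecs s" "r \<noteq> 0\<^sub>v s" by auto
    obtain p1 where p1: "p1 \<noteq> 0" "\<And>t. poly p1 t \<noteq> 0 \<Longrightarrow> P *\<^sub>v (W t *\<^sub>v r) \<noteq> 0\<^sub>v n"
      using twist_image_nz[OF P[unfolded s_def] A AP[unfolded C_def] Pnz[unfolded s_def]
          r(1)[unfolded s_def] r(2)[unfolded s_def]] unfolding W_def by blast
    obtain p2 where p2: "p2 \<noteq> 0" "\<And>t. poly p2 t \<noteq> 0 \<Longrightarrow> Z *\<^sub>v (W t *\<^sub>v r) \<noteq> 0\<^sub>v k"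
      using twist_image_nz[OF Z[unfolded s_def] B BZ[unfolded C_def] Znz[unfolded s_def]
          r(1)[unfolded s_def] r(2)[unfolded s_def]] unfolding W_def by blast
    obtain i j where "i < N" "j < N" "block_vec ?d r i \<bullet> block_vec ?d u j \<noteq> 0"
      using block[OF r] unfolding u_def by blast
    then obtain p3 where p3: "p3 \<noteq> 0" "\<And>t. t > 0 \<Longrightarrow> poly p3 t \<noteq> 0 \<Longrightarrow> r \<bullet> (W' t *\<^sub>v u) \<noteq> 0"
      using untwist_scalar_prod_nz[OF int_vecs_carrier[OF r(1), unfolded s_def] u[unfolded s_def]]
      unfolding W'_def by blast
    show "\<exists>p. p \<noteq> 0 \<and> (\<forall>t>0. poly p t \<noteq> 0 \<longrightarrow>
        P *\<^sub>v (W t *\<^sub>v r) \<noteq> 0\<^sub>v n \<and> Z *\<^sub>v (W t *\<^sub>v r) \<noteq> 0\<^sub>v k \<and> r \<bullet> (W' t *\<^sub>v u) \<noteq> 0)"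
    proof (intro exI[of _ "p1 * p2 * p3"] conjI allI impI)
      show "p1 * p2 * p3 \<noteq> 0" using p1 p2 p3 by simp
      fix t :: real assume t: "t > 0" "poly (p1 * p2 * p3) t \<noteq> 0"
      show "P *\<^sub>v (W t *\<^sub>v r) \<noteq> 0\<^sub>v n" by (rule p1(2)) (use t in simp)
      show "Z *\<^sub>v (W t *\<^sub>v r) \<noteq> 0\<^sub>v k" by (rule p2(2)) (use t in simp)
      show "r \<bullet> (W' t *\<^sub>v u) \<noteq> 0" by (rule p3(2)) (use t in simp_all)
    qed
  qed
  then obtain t where t: "t > 0" and
    gen: "\<And>r. r \<in> int_vecs s \<Longrightarrow> r \<noteq> 0\<^sub>v s \<Longrightarrow>
      P *\<^sub>v (W t *\<^sub>v r) \<noteq> 0\<^sub>v n \<and> Z *\<^sub>v (W t *\<^sub>v r) \<noteq> 0\<^sub>v k \<and> r \<bullet> (W' t *\<^sub>v u) \<noteq> 0"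
    by blast
  have WW': "W t * W' t = 1\<^sub>m s" "W' t * W t = 1\<^sub>m s"
    unfolding W_def W'_def s_def
    by (simp_all add: kron_mult[of _ N N _ ?d ?d _ N _ ?d] twist_untwist[OF t] kron_one)
  have CW: "C * W t = W t * C"
    unfolding C_def W_def using Cr_carrier
      left_mult_one_mat[OF twist_carrier(1)] right_mult_one_mat[OF twist_carrier(1)]
    by (simp add: kron_mult[of _ N N _ ?d ?d _ N _ ?d])
  let ?X = "P * W t" and ?Y = "Z * W t"
  have X: "?X \<in> carrier_mat n s" and Y': "?Y \<in> carrier_mat k s"
    using mult_carrier_mat[OF P W(1)] mult_carrier_mat[OF Z W(1)] .
  have SY: "append_cols S Y \<in> carrier_mat s s" using append_cols_carrier[OF S Y] ns by simp
  have PZ: "P @\<^sub>r Z \<in> carrier_mat s s" using carrier_append_rows[OF P Z] ns by simp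
  have "(P @\<^sub>r Z) * append_cols S Y = 1\<^sub>m s"
    unfolding append_rows_mult_append_cols[OF P Z S Y] using PS PY ZS ZY ns by simp
  hence "(P @\<^sub>r Z) * W t * (W' t * append_cols S Y) = 1\<^sub>m s"
    by (rule right_inverse_mult[OF PZ W(1) SY W(2) _ WW'(1)])
  hence "det ((P @\<^sub>r Z) * W t) * det (W' t * append_cols S Y) = 1"
    using det_mult[OF mult_carrier_mat[OF PZ W(1)] mult_carrier_mat[OF W(2) SY], of t t] by simp
  hence det: "det (?X @\<^sub>r ?Y) \<noteq> 0"
    unfolding append_rows_mult[OF P Z W(1)] by auto
  have Cint: "\<forall>i < s. \<forall>j < s. C $$ (i, j) \<in> \<int>"
  proof -
    have "Cr $$ (i, j) \<in> \<int>" if "i < ?d" "j < ?d" for i j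
    proof -
      have "real_of_rat (poly.coeff f l) \<in> \<int>" for l
        using int[of l] by (auto elim!: Ints_cases)
      thus ?thesis using that by (auto simp: companion_def)
    qed
    thus ?thesis unfolding C_def s_def using Cr_carrier
      by (auto simp: index_kron[of _ N N _ ?d ?d] less_mult_imp_div_less mod_less_mult)
  qed
  have assoc: "?X *\<^sub>v r = P *\<^sub>v (W t *\<^sub>v r)" "?Y *\<^sub>v r = Z *\<^sub>v (W t *\<^sub>v r)" if "r \<in> carrier_vec s" for r
    using assoc_mult_mat_vec[OF P W(1) that] assoc_mult_mat_vec[OF Z W(1) that] by auto
  have "self_similarity s n (?X @\<^sub>r ?Y) A"
  proof (rule self_similarityI[OF A _ X _ C n(1) ns(1) det Cint])
    show "B \<in> carrier_mat (s - n) (s - n)" "?Y \<in> carrier_mat (s - n) s"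
      using B Y' by (simp_all add: k_def)
    show "A * ?X = ?X * C" by (rule intertwine_mult[OF A C C P W(1) AP CW])
    show "B * ?Y = ?Y * C" by (rule intertwine_mult[OF B C C Z W(1) BZ CW])
    fix r assume r: "r \<in> int_vecs s" "r \<noteq> 0\<^sub>v s"
    show "?X *\<^sub>v r \<noteq> 0\<^sub>v n" "?Y *\<^sub>v r \<noteq> 0\<^sub>v (s - n)"
      unfolding assoc[OF int_vecs_carrier[OF r(1)]] using gen[OF r] by (simp_all add: k_def)
  next
    fix x :: "real vec" and \<epsilon> :: real assume x: "x \<in> carrier_vec (s - n)" and \<epsilon>: "\<epsilon> > 0"
    have W'u: "W' t *\<^sub>v u \<in> carrier_vec s" by (rule mult_mat_vec_carrier[OF W(2) u])
    have "?Y *\<^sub>v (W' t *\<^sub>v u) = Z *\<^sub>v ((W t * W' t) *\<^sub>v u)"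
      unfolding assoc(2)[OF W'u] using assoc_mult_mat_vec[OF W(1) W(2) u] by simp
    hence 0: "?Y *\<^sub>v (W' t *\<^sub>v u) = 0\<^sub>v k" using u by (simp add: WW' Zu)
    have "?Y * (W' t * Y) = 1\<^sub>m k" by (rule right_inverse_mult[OF Z W(1) Y W(2) ZY WW'(1)])
    from dense_image_int_vecs[OF Y' mult_carrier_mat[OF W(2) Y] this W'u 0 _ x[folded k_def] \<epsilon>] gen
    show "\<exists>r\<in>int_vecs s. \<forall>i < s - n. \<bar>x $ i - (?Y *\<^sub>v r) $ i\<bar> < \<epsilon>"
      unfolding k_def by blast
  qed
  thus ?thesis unfolding s_def by blast
qed

end

section \<open>Matrix polynomials and the lower bound\<close>

interpretation of_real_poly_hom: map_poly_inj_idom_hom complex_of_real ..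

definition mat_poly :: "'a :: comm_ring_1 poly \<Rightarrow> 'a mat \<Rightarrow> 'a mat" where
  "mat_poly p M = mat (dim_row M) (dim_row M) (\<lambda>(i, j). \<Sum>l\<le>degree p. poly.coeff p l * (M ^\<^sub>m l) $$ (i, j))"

lemma mat_poly_carrier [simp]: "M \<in> carrier_mat n n \<Longrightarrow> mat_poly p M \<in> carrier_mat n n"
  by (auto simp: mat_poly_def)

lemma mat_poly_intertwine:
  assumes A: "A \<in> carrier_mat n n" and C: "C \<in> carrier_mat s s" and X: "X \<in> carrier_mat n s"
    and AX: "A * X = X * C"
  shows "mat_poly p A * X = X * mat_poly p C"
proof (rule eq_matI)
  fix i j assume "i < dim_row (X * mat_poly p C)" "j < dim_col (X * mat_poly p C)"
  hence ij: "i < n" "j < s" using X C by (auto simp: mat_poly_def)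
  have Al: "A ^\<^sub>m l \<in> carrier_mat n n" and Cl: "C ^\<^sub>m l \<in> carrier_mat s s" for l
    using A C by (auto intro: pow_carrier_mat)
  have "(mat_poly p A * X) $$ (i, j) = (\<Sum>k<n. \<Sum>l\<le>degree p. poly.coeff p l * (A ^\<^sub>m l) $$ (i, k) * X $$ (k, j))"
    using A X ij by (simp add: mat_poly_def scalar_prod_def atLeast0LessThan sum_distrib_right)
  also have "\<dots> = (\<Sum>l\<le>degree p. poly.coeff p l * (A ^\<^sub>m l * X) $$ (i, j))"
    using X ij carrier_matD[OF Al]
    by (subst sum.swap) (simp add: scalar_prod_def atLeast0LessThan sum_distrib_left mult.assoc)
  also have "\<dots> = (\<Sum>l\<le>degree p. poly.coeff p l * (X * C ^\<^sub>m l) $$ (i, j))"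
    unfolding intertwine_pow[OF A X C AX] ..
  also have "\<dots> = (\<Sum>l\<le>degree p. \<Sum>k < s. poly.coeff p l * (X $$ (i, k) * (C ^\<^sub>m l) $$ (k, j)))"
    using X ij carrier_matD[OF Cl] by (simp add: scalar_prod_def atLeast0LessThan sum_distrib_left)
  also have "\<dots> = (X * mat_poly p C) $$ (i, j)"
    using C X ij by (subst sum.swap)
      (simp add: mat_poly_def scalar_prod_def atLeast0LessThan sum_distrib_left mult.left_commute)
  finally show "(mat_poly p A * X) $$ (i, j) = (X * mat_poly p C) $$ (i, j)" .
qed (use A C X in \<open>auto simp: mat_poly_def\<close>)

lemma mat_poly_mat_diag: "mat_poly p (mat_diag n w) = mat_diag n (\<lambda>i. poly p (w i))"
proof -
  have [simp]: "dim_row (mat_diag n w) = n" by (simp add: mat_diag_def)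
  show ?thesis unfolding mat_poly_def mat_diag_pow
    by (intro eq_matI) (auto simp: mat_diag_def poly_altdef)
qed

lemma (in inj_comm_ring_hom) mat_poly_hom:
  assumes "M \<in> carrier_mat n n"
  shows "map_mat hom (mat_poly p M) = mat_poly (map_poly hom p) (map_mat hom M)"
proof -
  have "(map_mat hom M ^\<^sub>m l) $$ (i, j) = hom ((M ^\<^sub>m l) $$ (i, j))" if "i < n" "j < n" for l i j
    using that carrier_matD[OF pow_carrier_mat[OF assms, of l]] by (simp flip: mat_hom_pow[OF assms])
  thus ?thesis using assms
    by (intro eq_matI) (auto simp: mat_poly_def hom_distribs)
qed

lemma mat_poly_eq_0_if_diagonalizable:
  assumes T: "T \<in> carrier_mat n n" "diagonalizable_C T"
    and ev: "\<And>z. z \<in> eigenvalues_C T \<Longrightarrow> poly p z = 0"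
  shows "mat_poly p T = 0\<^sub>m n n"
proof -
  obtain \<delta> V W where V: "V \<in> carrier_mat n n" and W: "W \<in> carrier_mat n n"
    and VW: "V * W = 1\<^sub>m n" and TV: "T * V = V * mat_diag n \<delta>"
    and \<delta>: "\<And>k. k < n \<Longrightarrow> \<delta> k \<in> eigenvalues_C T"
    by (rule diagonalizable_C_obtain[OF T(2,1)]) blast
  have pT: "mat_poly p T \<in> carrier_mat n n" using T(1) by simp
  have "mat_poly p (mat_diag n \<delta>) = 0\<^sub>m n n"
    unfolding mat_poly_mat_diag using ev \<delta> by (intro eq_matI) (auto simp: mat_diag_def)
  hence "mat_poly p T * V = 0\<^sub>m n n"
    using mat_poly_intertwine[OF T(1) mat_diag_dim V TV, of p] V by simp
  hence "0\<^sub>m n n = mat_poly p T * V * W" using W by simp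
  also have "\<dots> = mat_poly p T" using assoc_mult_mat[OF pT V W] pT by (simp add: VW)
  finally show ?thesis by simp
qed

text \<open>An eigenvector, read as a matrix with one column, intertwines \<open>M\<close> with the
  1 by 1 matrix of its eigenvalue, so the general intertwining rule for \<open>mat_poly\<close>
  applies.\<close>

lemma eigenvalue_root_if_mat_poly_eq_0:
  fixes M :: "complex mat"
  assumes M: "M \<in> carrier_mat n n" and "mat_poly p M = 0\<^sub>m n n" and "poly (char_poly M) z = 0"
  shows "poly p z = 0"
proof -
  obtain v where v: "v \<in> carrier_vec n" "v \<noteq> 0\<^sub>v n" "M *\<^sub>v v = z \<cdot>\<^sub>v v"
    using assms(3) eigenvalue_root_char_poly[OF M] M by (auto simp: eigenvalue_def eigenvector_def)
  define X where "X = mat n 1 (\<lambda>(i, _). v $ i)"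
  have X: "X \<in> carrier_mat n 1" by (simp add: X_def)
  have MX: "M * X = X * mat_diag 1 (\<lambda>_. z)"
  proof (rule eq_matI)
    fix i j assume "i < dim_row (X * mat_diag 1 (\<lambda>_. z))" "j < dim_col (X * mat_diag 1 (\<lambda>_. z))"
    hence ij: "i < n" "j = 0" by (auto simp: X_def mat_diag_def)
    have "(M * X) $$ (i, 0) = (M *\<^sub>v v) $ i"
      using ij carrier_matD[OF M] carrier_vecD[OF v(1)] by (simp add: X_def scalar_prod_def)
    also have "\<dots> = (X * mat_diag 1 (\<lambda>_. z)) $$ (i, 0)"
      unfolding v(3) mat_diag_mult_right[OF X] using ij v(1) by (simp add: X_def)
    finally show "(M * X) $$ (i, j) = (X * mat_diag 1 (\<lambda>_. z)) $$ (i, j)" using ij by simp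
  qed (use M in \<open>auto simp: X_def mat_diag_def\<close>)
  have "X * mat_diag 1 (\<lambda>_. poly p z) = 0\<^sub>m n 1"
    using mat_poly_intertwine[OF M mat_diag_dim X MX, of p] assms(2) X by (simp add: mat_poly_mat_diag)
  moreover have "(X * mat_diag 1 (\<lambda>_. poly p z)) $$ (i, 0) = v $ i * poly p z" if "i < n" for i
    unfolding mat_diag_mult_right[OF X] using that by (simp add: X_def)
  ultimately have "v $ i * poly p z = 0" if "i < n" for i
    using that by simp
  moreover obtain i where "i < n" "v $ i \<noteq> 0"
    using v by (metis carrier_vecD eq_vecI index_zero_vec)
  ultimately show ?thesis by auto
qed

lemma char_poly_four_block_diag:
  fixes A B :: "'a :: idom mat"
  assumes A: "A \<in> carrier_mat n n" and B: "B \<in> carrier_mat k k"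
  shows "char_poly (four_block_mat A (0\<^sub>m n k) (0\<^sub>m k n) B) = char_poly A * char_poly B"
proof -
  have "char_poly_matrix (four_block_mat A (0\<^sub>m n k) (0\<^sub>m k n) B) =
      four_block_mat (char_poly_matrix A) (0\<^sub>m n k) (0\<^sub>m k n) (char_poly_matrix B)"
    using A B by (intro eq_matI) (auto simp: char_poly_matrix_def)
  thus ?thesis
    unfolding char_poly_def using A B
    by (simp add: det_four_block_mat_upper_right_zero[of _ n _ k])
qed

context min_poly_Q
begin

text \<open>The number \<open>k\<close> is the common order of the characteristic polynomial of
  \<open>C\<close> at the roots of \<open>f\<close>; the multiplicities of \<open>A\<close> are at
  most \<open>k\<close> because that polynomial is the product of those of \<open>A\<close> and
  \<open>B\<close>.\<close>

lemma dimension_self_similarity: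
  fixes A :: "real mat"
  defines "T \<equiv> map_mat complex_of_real A"
  assumes sim: "self_similarity s n L A" and diag: "diagonalizable_C T"
    and ev: "eigenvalues_C T \<subseteq> roots_C f" and int: "\<And>i. poly.coeff f i \<in> \<int>"
  obtains k where "s = k * degree f" "\<And>\<beta>. \<beta> \<in> roots_C f \<Longrightarrow> alg_mult T \<beta> \<le> k"
proof -
  obtain C B where gen: "generic_cps s n L" and A: "A \<in> carrier_mat n n" and C: "C \<in> carrier_mat s s"
    and Cint: "\<And>i j. i < s \<Longrightarrow> j < s \<Longrightarrow> C $$ (i, j) \<in> \<int>"
    and B: "B \<in> carrier_mat (s - n) (s - n)"
    and DL: "four_block_mat A (0\<^sub>m n (s - n)) (0\<^sub>m (s - n) n) B * L = L * C"
    using sim unfolding self_similarity_def by blast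
  have n: "n < s" and L: "L \<in> carrier_mat s s" and detL: "det L \<noteq> 0"
    and inj: "inj_on (proj_par n) (lattice L)"
    using gen by (auto simp: generic_cps_def cps_def)
  let ?D = "four_block_mat A (0\<^sub>m n (s - n)) (0\<^sub>m (s - n) n) B"
  have D: "?D \<in> carrier_mat s s" using four_block_carrier_mat[OF A B] n by simp
  define X where "X = mat n s (\<lambda>(i, j). L $$ (i, j))"
  define Y where "Y = mat (s - n) s (\<lambda>(i, j). L $$ (n + i, j))"
  have X: "X \<in> carrier_mat n s" and Y: "Y \<in> carrier_mat (s - n) s" by (auto simp: X_def Y_def)
  have LXY: "L = X @\<^sub>r Y"
    using L n by (intro eq_matI) (auto simp: X_def Y_def append_rows_def)
  have AX: "A * X = X * C"
    using DL four_block_diag_mult_append_rows[OF A B X Y] append_rows_mult[OF X Y C]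
      append_rows_inj(1)[of "A * X" "B * Y" "X * C" "Y * C" n s "s - n"] A B C X Y
    unfolding LXY by auto
  let ?r = "of_rat :: rat \<Rightarrow> real" and ?c = "of_rat :: rat \<Rightarrow> complex"
  let ?F = "map_poly ?r f" and ?M = "mat_poly (map_poly ?r f) C"
  have T: "T \<in> carrier_mat n n" using A by (simp add: T_def)
  \<comment> \<open>f(A) vanishes over the complex numbers, where \<open>A\<close> is
    diagonalizable; the equation is then read back over the reals.\<close>
  have "map_mat complex_of_real (mat_poly ?F A) = mat_poly (map_poly ?c f) T"
    unfolding T_def of_real_hom.mat_poly_hom[OF A] map_poly_complex_of_rat ..
  also have "\<dots> = 0\<^sub>m n n"
    using ev by (intro mat_poly_eq_0_if_diagonalizable[OF T diag]) (auto simp: roots_C_def)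
  finally have FT: "map_mat complex_of_real (mat_poly ?F A) = 0\<^sub>m n n" .
  have FA: "mat_poly ?F A = 0\<^sub>m n n"
  proof (rule eq_matI)
    fix i j assume "i < dim_row (0\<^sub>m n n :: real mat)" "j < dim_col (0\<^sub>m n n :: real mat)"
    hence ij: "i < n" "j < n" by auto
    have "complex_of_real (mat_poly ?F A $$ (i, j)) = map_mat complex_of_real (mat_poly ?F A) $$ (i, j)"
      using ij carrier_matD[OF mat_poly_carrier[OF A]] by simp
    also have "\<dots> = 0" unfolding FT using ij by simp
    finally show "mat_poly ?F A $$ (i, j) = 0\<^sub>m n n $$ (i, j)" using ij by simp
  qed (use carrier_matD[OF mat_poly_carrier[OF A]] in simp_all)
  have M: "?M \<in> carrier_mat s s" using C by simp
  have XM: "X * ?M = 0\<^sub>m n s"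
    using mat_poly_intertwine[OF A C X AX, of ?F] X by (simp add: FA)
  \<comment> \<open>Integrality of both \<open>C\<close> and \<open>f\<close> makes the columns of
    f(C) coordinates of lattice points.\<close>
  have Mint: "?M $$ (i, j) \<in> \<int>" if "i < s" "j < s" for i j
  proof -
    have "(C ^\<^sub>m l) $$ (i, j) \<in> \<int>" if "i < s" for l i
      using that
    proof (induction l arbitrary: i)
      case 0
      thus ?case using C \<open>j < s\<close> by simp
    next
      case (Suc l)
      have "(C ^\<^sub>m Suc l) $$ (i, j) = (C * C ^\<^sub>m l) $$ (i, j)" using pow_mult_commute[OF C] by simp
      also have "\<dots> = (\<Sum>m < s. C $$ (i, m) * (C ^\<^sub>m l) $$ (m, j))"
        using C pow_carrier_mat[OF C, of l] Suc.prems \<open>j < s\<close> by (simp add: scalar_prod_def atLeast0LessThan)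
      also have "\<dots> \<in> \<int>" using Suc Cint by (intro Ints_sum Ints_mult) auto
      finally show ?case .
    qed
    moreover have "?r (poly.coeff f l) \<in> \<int>" for l using int[of l] by (auto elim!: Ints_cases)
    ultimately show ?thesis using that C by (auto simp: mat_poly_def intro!: Ints_sum Ints_mult)
  qed
  have M0: "?M = 0\<^sub>m s s"
  proof (rule eq_matI)
    fix i j assume "i < dim_row (0\<^sub>m s s :: real mat)" "j < dim_col (0\<^sub>m s s :: real mat)"
    hence ij: "i < s" "j < s" by auto
    \<comment> \<open>The lattice point with coordinates \<open>r\<close> has the same parallel
      projection as the origin, so it is the origin.\<close>
    define r where "r = col ?M j"
    have r: "r \<in> int_vecs s" using Mint ij carrier_matD[OF M] by (auto simp: r_def int_vecs_def)
    have z: "0\<^sub>v s \<in> int_vecs s" by (simp add: int_vecs_def)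
    have "X *\<^sub>v r = col (X * ?M) j" unfolding r_def using col_mult2[OF X M ij(2)] by simp
    also have "\<dots> = X *\<^sub>v 0\<^sub>v s" unfolding XM using ij X by (intro eq_vecI) (auto simp: scalar_prod_def)
    finally have "proj_par n (L *\<^sub>v r) = proj_par n (L *\<^sub>v 0\<^sub>v s)"
      unfolding LXY using proj_append_rows_mult(1)[OF X Y int_vecs_carrier] r z by simp
    hence "L *\<^sub>v r = L *\<^sub>v 0\<^sub>v s"
      using inj r z unfolding lattice_int_vecs[OF L] by (auto dest: inj_onD)
    hence "L *\<^sub>v r = 0\<^sub>v s" using L by (auto simp: scalar_prod_def intro!: eq_vecI)
    hence "r = 0\<^sub>v s" using det_0_iff_vec_prod_zero_field[OF L] detL int_vecs_carrier[OF r] by blast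
    hence "r $ i = 0" using ij by simp
    thus "?M $$ (i, j) = 0\<^sub>m s s $$ (i, j)" using ij carrier_matD[OF M] by (simp add: r_def)
  qed (use M in auto)
  \<comment> \<open>A rational copy of \<open>C\<close>: the equality of orders at conjugate roots
    is a statement about rational polynomials.\<close>
  define Cq where "Cq = mat s s (\<lambda>(i, j). rat_of_int \<lfloor>C $$ (i, j)\<rfloor>)"
  have Cq: "Cq \<in> carrier_mat s s" by (simp add: Cq_def)
  have CCq: "C = map_mat ?r Cq"
    using C Cint by (intro eq_matI) (auto simp: Cq_def)
  let ?Cc = "map_mat complex_of_real C"
  have Cc: "?Cc \<in> carrier_mat s s" using C by simp
  have cp: "char_poly ?Cc = map_poly ?c (char_poly Cq)"
  proof -
    have "char_poly C = map_poly ?r (char_poly Cq)"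
      unfolding CCq by (rule of_rat_hom.char_poly_hom[OF Cq])
    thus ?thesis by (simp only: of_real_hom.char_poly_hom[OF C] map_poly_complex_of_rat)
  qed
  have "mat_poly (map_poly ?c f) ?Cc = map_mat complex_of_real ?M"
    unfolding of_real_hom.mat_poly_hom[OF C] map_poly_complex_of_rat ..
  also have "\<dots> = 0\<^sub>m s s" unfolding M0 by (intro eq_matI) auto
  finally have FC: "mat_poly (map_poly ?c f) ?Cc = 0\<^sub>m s s" .
  have sub: "{z. poly (map_poly ?c (char_poly Cq)) z = 0} \<subseteq> roots_C f"
    using eigenvalue_root_if_mat_poly_eq_0[OF Cc FC] unfolding cp roots_C_def by blast
  have dq: "degree (char_poly Cq) = s" and nz: "char_poly Cq \<noteq> 0"
    using degree_monic_char_poly[OF Cq] by auto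
  have mult: "s = order \<beta> (char_poly ?Cc) * degree f" if "\<beta> \<in> roots_C f" for \<beta>
    using degree_eq_mult_order[OF nz sub that] dq unfolding cp by simp
  obtain L' where L': "L' \<in> carrier_mat s s" "L * L' = 1\<^sub>m s" "L' * L = 1\<^sub>m s"
    using det_nz_inverse[OF L detL] .
  have "C = L' * ?D * L"
    using assoc_mult_mat[OF L'(1) D L] assoc_mult_mat[OF L'(1) L C] C by (simp add: DL L')
  hence "similar_mat C ?D"
    using C D L L' by (intro similar_matI[of _ _ L' L s]) auto
  hence "char_poly C = char_poly A * char_poly B"
    using char_poly_similar char_poly_four_block_diag[OF A B] by metis
  hence "char_poly ?Cc = char_poly T * map_poly complex_of_real (char_poly B)"
    unfolding T_def of_real_hom.char_poly_hom[OF C] of_real_hom.char_poly_hom[OF A]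
    by (simp add: of_real_poly_hom.hom_mult)
  moreover have "char_poly ?Cc \<noteq> 0" using degree_monic_char_poly[OF Cc] by auto
  ultimately have le: "alg_mult T \<beta> \<le> order \<beta> (char_poly ?Cc)" for \<beta>
    by (simp add: alg_mult_def order_mult)
  \<comment> \<open>The order does not depend on the root, so the single \<open>k\<close> obtained
    at the fixed eigenvalue bounds all multiplicities.\<close>
  have "order \<beta> (char_poly ?Cc) = order \<beta>\<^sub>0 (char_poly ?Cc)" if "\<beta> \<in> roots_C f" for \<beta>
    unfolding cp using order_eq[OF nz that min_poly_root] .
  thus ?thesis using that mult[OF min_poly_root] le by metis
qed

end

theorem theorem3:
  fixes A :: "real mat" and n d :: nat and f :: "rat poly"
  assumes "A \<in> carrier_mat n n" and "1 \<le> n"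
    and "diagonalizable_C (map_mat complex_of_real A)"
    and "\<forall>\<beta> \<in> eigenvalues_C (map_mat complex_of_real A). algebraic_int \<beta> \<and> is_min_poly_Q f \<beta>"
    and "d = degree f"
  shows "\<forall>s L. self_similarity s n L A \<and> (\<forall>s' L'. self_similarity s' n L' A \<longrightarrow> s \<le> s') \<longrightarrow>
           s = (let M = Max (alg_mult (map_mat complex_of_real A) ` roots_C f);
                    m = Min (alg_mult (map_mat complex_of_real A) ` roots_C f)
                in if m < M then M * d else (M + 1) * d)"
proof (intro allI impI)
  fix s L assume "self_similarity s n L A \<and> (\<forall>s' L'. self_similarity s' n L' A \<longrightarrow> s \<le> s')"
  hence sim: "self_similarity s n L A" and least: "\<And>s' L'. self_similarity s' n L' A \<Longrightarrow> s \<le> s'"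
    by blast+
  let ?T = "map_mat complex_of_real A" and ?mult = "alg_mult (map_mat complex_of_real A)"
  have T: "?T \<in> carrier_mat n n" using assms(1) by simp
  have cp: "degree (char_poly ?T) = n" "char_poly ?T \<noteq> 0" using degree_monic_char_poly[OF T] assms(2) by auto
  \<comment> \<open>As \<open>1 \<le> n\<close>, an eigenvalue exists; it is what ties
    \<open>f\<close> to an actual minimal polynomial, the hypothesis being a statement about all
    eigenvalues.\<close>
  hence "\<not> constant (poly (char_poly ?T))" using assms(2) by (simp add: constant_degree)
  then obtain \<beta> where \<beta>: "\<beta> \<in> eigenvalues_C ?T"
    using fundamental_theorem_of_algebra by (auto simp: eigenvalues_C_def)
  interpret min_poly_Q f \<beta> by standard (use assms(4) \<beta> in blast)
  have int: "poly.coeff f i \<in> \<int>" for i using assms(4) \<beta> by (intro coeff_Ints) blast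
  have ev: "eigenvalues_C ?T \<subseteq> roots_C f"
    using assms(4) by (auto simp: is_min_poly_Q_def roots_C_def)
  have n: "n = (\<Sum>z\<in>roots_C f. ?mult z)"
    using degree_eq_sum_order[OF finite_roots _ cp(2)] ev cp(1)
    by (simp add: alg_mult_def eigenvalues_C_def)
  define M where "M = Max (?mult ` roots_C f)"
  define m where "m = Min (?mult ` roots_C f)"
  have ne: "roots_C f \<noteq> {}" using min_poly_root by auto
  have M: "?mult z \<le> M" if "z \<in> roots_C f" for z using that finite_roots by (simp add: M_def)
  have m: "m \<le> ?mult z" if "z \<in> roots_C f" for z using that finite_roots by (simp add: m_def)
  have "M \<in> ?mult ` roots_C f" unfolding M_def using finite_roots ne by (intro Max_in) auto
  then obtain zM where zM: "zM \<in> roots_C f" "?mult zM = M" by auto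
  have "m \<in> ?mult ` roots_C f" unfolding m_def using finite_roots ne by (intro Min_in) auto
  then obtain zm where zm: "zm \<in> roots_C f" "?mult zm = m" by auto
  \<comment> \<open>Outside the roots of \<open>f\<close> the multiplicity is zero, so
    \<open>M\<close> bounds it everywhere.\<close>
  have M': "?mult z \<le> M" for z
  proof (cases "z \<in> roots_C f")
    case False
    hence "poly (char_poly ?T) z \<noteq> 0" using ev by (auto simp: eigenvalues_C_def)
    thus ?thesis by (simp add: alg_mult_def order_0I)
  qed (rule M)
  obtain k where k: "s = k * d" "\<And>\<beta>. \<beta> \<in> roots_C f \<Longrightarrow> ?mult \<beta> \<le> k"
    using dimension_self_similarity[OF sim assms(3) ev int] assms(5) by blast
  have Mk: "M \<le> k" using k(2)[OF zM(1)] zM(2) by simp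
  have "s = (if m < M then M * d else (M + 1) * d)"
  proof (cases "m < M")
    case True
    \<comment> \<open>Strict because the root \<open>zm\<close> has multiplicity below
      \<open>M\<close>; this leaves room for a perpendicular part within M d dimensions.\<close>
    have "n < (\<Sum>z\<in>roots_C f. M)"
      unfolding n using M zm True finite_roots by (intro sum_strict_mono_ex1) auto
    hence "n < M * d" by (simp add: card_roots assms(5) mult.commute)
    then obtain L' where "self_similarity (M * d) n L' A"
      using exists_self_similarity[OF assms(1,3) ev M' assms(2) _ int] assms(5) by blast
    hence "s \<le> M * d" by (rule least)
    moreover have "M * d \<le> s" using Mk k(1) by simp
    ultimately show ?thesis using True by simp
  next
    case False
    hence "?mult z = M" if "z \<in> roots_C f" for z using M[OF that] m[OF that] by simp
    hence nM: "n = M * d" using n by (simp add: card_roots assms(5) mult.commute)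
    have "d > 0" using degree_f_pos assms(5) by simp
    have "?mult z \<le> M + 1" for z using M'[of z] by simp
    moreover have "n < (M + 1) * d" using nM \<open>d > 0\<close> by simp
    ultimately obtain L' where "self_similarity ((M + 1) * d) n L' A"
      using exists_self_similarity[OF assms(1,3) ev _ assms(2) _ int] assms(5) by blast
    hence "s \<le> (M + 1) * d" by (rule least)
    \<comment> \<open>Here \<open>A\<close> fills \<open>M\<close> copies entirely, and
      \<open>n < s\<close> forces at least one more.\<close>
    moreover have "n < s" using sim by (simp add: self_similarity_def generic_cps_def cps_def)
    hence "M < k" using nM k(1) by simp
    hence "(M + 1) * d \<le> s" unfolding k(1) by (intro mult_right_mono) auto
    ultimately show ?thesis using False by simp
  qed
  thus "s = (let M = Max (?mult ` roots_C f); m = Min (?mult ` roots_C f)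
      in if m < M then M * d else (M + 1) * d)"
    by (simp add: Let_def M_def m_def)
qed

end
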